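(* Let $(X_t,V_t)_{t\ge 0}$ be an affine stochastic volatility model satisfying the standing assumptions, and let $T>0$. Assume that one of the following conditions is verified: (1) the effective domain $J$ of $u\mapsto F(u,w(u))$ is $J=[u_-,u_+]$ and $w(u_-)=w(u_+)$; (2) for every $u\in\mathbb R$, $\tilde w(u)=\infty$, i.e. the generalized Riccati equation for $\psi$ has only one (stable) equilibrium. For $x\in\mathcal F([0,T],\mathbb R)=\{x:[0,T]\to\mathbb R,\ x_0=0\}$ let $$\Lambda^*(x)=\sup_\tau\ \sup_{\Theta\in J^n}\left\{\sum_{j=1}^n\Theta_j(x_{t_j}-x_{t_{j-1}})-\sum_{j=1}^n(t_j-t_{j-1})\,h(\Theta_j)\right\},$$ where $\tau=\{0<t_1<\dots<t_n\le T\}$ ranges over finite sets and $t_0=0$ (this is the rate function of the large deviation principle, on $\mathcal F([0,T],\mathbb R)$ with the topology of pointwise convergence, of $(\epsilon X_{t/\epsilon})_{0\le t\le T}$ as $\epsilon\to0$). Then $$\Lambda^*(x)=\int_0^T h^*(\dot x^{ac}_t)\,dt+\int_0^T\mathcal H\!\left(\frac{d\nu_t}{d\theta_t}\right)d\theta_t,$$ where $$h^*(y)=\sup_{\theta\in J}\{\theta y-h(\theta)\},\qquad \mathcal H(y)=\lim_{\epsilon\to0}\epsilon\,h^*(y/\epsilon),$$ $\dot x^{ac}$ is the derivative of the absolutely continuous part of $x$, $\nu_t$ is the singular component of $dx_t$ with respect to $dt$, and $\theta_t$ is any non-negative, finite, regular, $\mathbb R$-valued Borel measure on $[0,T]$ with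 respect to which $\nu_t$ is absolutely continuous.
   Context: An affine stochastic volatility (ASV) model is a stochastically continuous, time-homogeneous Markov process $(X_t,V_t)_{t\ge0}$ on $\mathbb R\times\mathbb R_+$ such that $(e^{X_t})_{t\ge 0}$ is a martingale and $\mathbb E(e^{uX_t+wV_t}\mid X_0=x,V_0=v)=e^{\phi(t,u,w)+\psi(t,u,w)v+ux}$ for all $(t,u,w)\in\mathbb R_+\times\mathbb C^2$. Then $\phi,\psi$ satisfy the generalized Riccati equations $\partial_t\phi(t,u,w)=F(u,\psi(t,u,w))$, $\phi(0,u,w)=0$, and $\partial_t\psi(t,u,w)=R(u,\psi(t,u,w))$, $\psi(0,u,w)=w$, where, with $D=\mathbb R\times\mathbb R_+$ and $z=(u,w)^\top$, $F(u,w)=\frac12 z^\top a z+b\cdot z+\int_{D\setminus\{0\}}(e^{xu+yw}-1-w_F(x,y)\cdot z)\,m(dx,dy)$ and $R(u,w)=\frac12 z^\top\alpha z+\beta\cdot z+\int_{D\setminus\{0\}}(e^{xu+yw}-1-w_R(x,y)\cdot z)\,\mu(dx,dy)$, with $w_F(x,y)=(\frac{x}{1+x^2},0)^\top$, $w_R(x,y)=(\frac{x}{1+x^2},\frac{y}{1+y^2})^\top$; $a,\alpha$ are positive semi-definite $2\times2$ matrices with $a_{12}=a_{21}=a_{22}=0$, $b\in D$, $\beta\in\mathbb R^2$, $m,\mu$ are Lévy measures on $D$ and $\int_{D\setminus\{0\}}((x^2+y)\wedge1)\,m(dx,dy)<\infty$. Let $\chi(u)=\partial_wR(u,w)|_{w=0}=\alpha_{12}u+\beta_2+\int_{D\setminus\{0\}}y(e^{xu}-\frac1{1+y^2})\,\mu(dx,dy)$.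 Standing assumptions: there is $u\in\mathbb R$ with $R(u,0)\ne0$; $F(1,0)=R(1,0)=0$ and $\chi(0)+\chi(1)<\infty$; $\chi(0)<0$ and $\chi(1)<0$; the process starts at $X_0=0$ and a deterministic $V_0$. It is known that there is then an interval $I\supseteq[0,1]$ such that for $u\in I$ the equation $\partial_t\psi=R(u,\psi)$ has a unique stable equilibrium $w(u)$ and at most one other equilibrium $\tilde w(u)$, which is unstable (one sets $\tilde w(u)=\infty$ if there is no other equilibrium), and for $u\notin I$ it has no equilibrium. $J=\{u\in I: F(u,w(u))<\infty\}$ is an interval with $[0,1]\subseteq J\subseteq I$, and $h(u)=F(u,w(u))=\lim_{\epsilon\to0}\epsilon\log\mathbb E[e^{uX_{1/\epsilon}}]$ for $u\in J$, $h=+\infty$ outside $J$. It is further assumed that (i) there exists $u<0$ with $h(u)<\infty$, and (ii) $h$ is essentially smooth: the interior of its effective domain is non-empty, $h$ is differentiable there, and $|h'(u_n)|\to\infty$ along any sequence in the interior converging to a boundary point of the domain. Convention: $dx_t$ denotes the measure associated with a function $x$ of bounded variation; if $x$ is not of bounded variation, the right-hand side of the formula is understood as $+\infty$.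
   Formalization: For x of bounded variation the formula is proved only if, at each interior time, the value of x lies between its one-sided limits; it fails for other paths, e.g. the indicator of a point, where dx=0 but the supremum exceeds T h*(0). *)

theory Defs
  imports "HOL-Probability.Probability"
begin

section \<open>Levy--Khintchine exponents on the state space\<close>

definition state_space :: "(real \<times> real) set" where
  "state_space = UNIV \<times> {0..}"

definition levy_measure :: "(real \<times> real) measure \<Rightarrow> bool" where
  "levy_measure m \<longleftrightarrow> sets m = sets borel \<and> emeasure m (- state_space) = 0 \<and> emeasure m {0} = 0 \<and>
     (\<integral>\<^sup>+ p. ennreal (min 1 ((norm p)\<^sup>2)) \<partial>m) < \<infinity>"

definition pos_semidef :: "real^2^2 \<Rightarrow> bool" where
  "pos_semidef A \<longleftrightarrow> transpose A = A \<and> (\<forall>z. 0 \<le> z \<bullet> (A *v z))"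

definition cdot :: "real^2 \<Rightarrow> complex^2 \<Rightarrow> complex" where
  "cdot b z = (\<Sum>i\<in>UNIV. of_real (b$i) * z$i)"

definition cquad :: "real^2^2 \<Rightarrow> complex^2 \<Rightarrow> complex" where
  "cquad A z = (\<Sum>i\<in>UNIV. \<Sum>j\<in>UNIV. of_real (A$i$j) * z$i * z$j)"

definition trunc_F :: "real \<times> real \<Rightarrow> real^2" where
  "trunc_F p = vector [fst p / (1 + (fst p)\<^sup>2), 0]"

definition trunc_R :: "real \<times> real \<Rightarrow> real^2" where
  "trunc_R p = vector [fst p / (1 + (fst p)\<^sup>2), snd p / (1 + (snd p)\<^sup>2)]"

definition lk_integrand :: "(real \<times> real \<Rightarrow> real^2) \<Rightarrow> complex^2 \<Rightarrow> real \<times> real \<Rightarrow> complex" where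
  "lk_integrand tr z p =
     exp (of_real (fst p) * z$1 + of_real (snd p) * z$2) - 1 - cdot (tr p) z"

definition lk_defined ::
    "(real \<times> real \<Rightarrow> real^2) \<Rightarrow> (real \<times> real) measure \<Rightarrow> complex \<Rightarrow> complex \<Rightarrow> bool" where
  "lk_defined tr m u w \<longleftrightarrow> set_integrable m (state_space - {0}) (lk_integrand tr (vector [u, w]))"

definition lk_exponent ::
    "(real \<times> real \<Rightarrow> real^2) \<Rightarrow> real^2^2 \<Rightarrow> real^2 \<Rightarrow> (real \<times> real) measure \<Rightarrow> complex \<Rightarrow> complex \<Rightarrow> complex"
  where
  "lk_exponent tr A b m u w =
     cquad A (vector [u, w]) / 2 + cdot b (vector [u, w]) +
     (LINT p:(state_space - {0})|m. lk_integrand tr (vector [u, w]) p)"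

record characteristics =
  diff_F :: "real^2^2"
  drift_F :: "real^2"
  jump_F :: "(real \<times> real) measure"
  diff_R :: "real^2^2"
  drift_R :: "real^2"
  jump_R :: "(real \<times> real) measure"

definition F_defined :: "characteristics \<Rightarrow> complex \<Rightarrow> complex \<Rightarrow> bool" where
  "F_defined C = lk_defined trunc_F (jump_F C)"

definition R_defined :: "characteristics \<Rightarrow> complex \<Rightarrow> complex \<Rightarrow> bool" where
  "R_defined C = lk_defined trunc_R (jump_R C)"

definition F_complex :: "characteristics \<Rightarrow> complex \<Rightarrow> complex \<Rightarrow> complex" where
  "F_complex C = lk_exponent trunc_F (diff_F C) (drift_F C) (jump_F C)"

definition R_complex :: "characteristics \<Rightarrow> complex \<Rightarrow> complex \<Rightarrow> complex" where
  "R_complex C = lk_exponent trunc_R (diff_R C) (drift_R C) (jump_R C)"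

text \<open>For real arguments the negative part of the integrand is always integrable (for admissible
  characteristics), so a divergent integral has the value \<open>+\<infinity>\<close>. The same holds for
  the integral defining \<open>chi\<close>.\<close>

definition F_real :: "characteristics \<Rightarrow> real \<Rightarrow> real \<Rightarrow> ereal" where
  "F_real C u w = (if F_defined C (of_real u) (of_real w)
     then ereal (Re (F_complex C (of_real u) (of_real w))) else \<infinity>)"

definition R_real :: "characteristics \<Rightarrow> real \<Rightarrow> real \<Rightarrow> ereal" where
  "R_real C u w = (if R_defined C (of_real u) (of_real w)
     then ereal (Re (R_complex C (of_real u) (of_real w))) else \<infinity>)"

definition chi :: "characteristics \<Rightarrow> real \<Rightarrow> ereal" where
  "chi C u =
     (let f = (\<lambda>p :: real \<times> real. snd p * (exp (fst p * u) - 1 / (1 + (snd p)\<^sup>2)))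
      in if set_integrable (jump_R C) (state_space - {0}) f
         then ereal (diff_R C $ 1 $ 2 * u + drift_R C $ 2 + (LINT p:(state_space - {0})|jump_R C. f p))
         else \<infinity>)"

definition admissible :: "characteristics \<Rightarrow> bool" where
  "admissible C \<longleftrightarrow>
     pos_semidef (diff_F C) \<and> pos_semidef (diff_R C) \<and>
     diff_F C $ 1 $ 2 = 0 \<and> diff_F C $ 2 $ 1 = 0 \<and> diff_F C $ 2 $ 2 = 0 \<and>
     (drift_F C $ 1, drift_F C $ 2) \<in> state_space \<and>
     levy_measure (jump_F C) \<and> levy_measure (jump_R C) \<and>
     (\<integral>\<^sup>+ p\<in>state_space - {0}. ennreal (min 1 ((fst p)\<^sup>2 + snd p)) \<partial>jump_F C) < \<infinity>"

section \<open>Affine stochastic volatility models\<close>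

definition natural_filtration ::
    "'w measure \<Rightarrow> (real \<Rightarrow> 'w \<Rightarrow> real) \<Rightarrow> (real \<Rightarrow> 'w \<Rightarrow> real) \<Rightarrow> real \<Rightarrow> 'w measure" where
  "natural_filtration S X V s =
     sigma (space S)
       {(\<lambda>\<omega>. (X r \<omega>, V r \<omega>)) -` B \<inter> space S | r B. 0 \<le> r \<and> r \<le> s \<and> B \<in> sets borel}"

text \<open>The Markov process is given as a family of laws \<open>P (x, v)\<close> on one measurable space \<open>S\<close>, so that
  the expectation conditional on \<open>X 0 = x\<close> and \<open>V 0 = v\<close> is the expectation under
  \<open>P (x, v)\<close>.\<close>

locale homogeneous_markov_process =
  fixes S :: "'w measure" and P :: "real \<times> real \<Rightarrow> 'w measure"
    and X V :: "real \<Rightarrow> 'w \<Rightarrow> real"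
  assumes prob: "z \<in> state_space \<Longrightarrow> prob_space (P z)"
    and sets_P: "z \<in> state_space \<Longrightarrow> sets (P z) = sets S"
    and X_measurable: "0 \<le> t \<Longrightarrow> X t \<in> borel_measurable S"
    and V_measurable: "0 \<le> t \<Longrightarrow> V t \<in> borel_measurable S"
    and V_nonneg: "0 \<le> t \<Longrightarrow> \<omega> \<in> space S \<Longrightarrow> 0 \<le> V t \<omega>"
    and start: "z \<in> state_space \<Longrightarrow> AE \<omega> in P z. (X 0 \<omega>, V 0 \<omega>) = z"
    and kernel: "0 \<le> t \<Longrightarrow> B \<in> sets borel \<Longrightarrow>
      (\<lambda>z. measure (P z) {\<omega> \<in> space S. (X t \<omega>, V t \<omega>) \<in> B})
        \<in> borel_measurable (restrict_space borel state_space)"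
    and markov: "z \<in> state_space \<Longrightarrow> 0 \<le> s \<Longrightarrow> 0 \<le> t \<Longrightarrow> B \<in> sets borel \<Longrightarrow>
      AE \<omega> in P z.
        real_cond_exp (P z) (natural_filtration S X V s)
          (indicator {\<omega>' \<in> space S. (X (s + t) \<omega>', V (s + t) \<omega>') \<in> B}) \<omega>
        = measure (P (X s \<omega>, V s \<omega>)) {\<omega>' \<in> space S. (X t \<omega>', V t \<omega>') \<in> B}"
    and stochastically_continuous: "z \<in> state_space \<Longrightarrow> 0 \<le> t \<Longrightarrow> 0 < e \<Longrightarrow>
      ((\<lambda>s. measure (P z) {\<omega> \<in> space S. e < dist (X s \<omega>, V s \<omega>) (X t \<omega>, V t \<omega>)}) \<longlongrightarrow> 0)
        (at t within {0..})"

text \<open>Exponential moments of complex order need not exist. The affine formula is required on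
  the set of all \<open>(t, u, w)\<close> for which they do, and the Riccati equations as long as the moments exist
  and the integrals in \<open>F\<close> and \<open>R\<close> converge.\<close>

locale affine_stochastic_volatility = homogeneous_markov_process S P X V
  for S :: "'w measure" and P :: "real \<times> real \<Rightarrow> 'w measure" and X V :: "real \<Rightarrow> 'w \<Rightarrow> real" +
  fixes \<phi> \<psi> :: "real \<Rightarrow> complex \<Rightarrow> complex \<Rightarrow> complex"
    and C :: characteristics
  assumes exp_integrable: "z \<in> state_space \<Longrightarrow> 0 \<le> t \<Longrightarrow> integrable (P z) (\<lambda>\<omega>. exp (X t \<omega>))"
    and exp_martingale: "z \<in> state_space \<Longrightarrow> 0 \<le> s \<Longrightarrow> s \<le> t \<Longrightarrow>
      AE \<omega> in P z. real_cond_exp (P z) (natural_filtration S X V s) (\<lambda>\<omega>'. exp (X t \<omega>')) \<omega>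
        = exp (X s \<omega>)"
    and affine: "0 \<le> t \<Longrightarrow>
      (\<forall>z\<in>state_space. integrable (P z) (\<lambda>\<omega>. exp (u * of_real (X t \<omega>) + w * of_real (V t \<omega>)))) \<Longrightarrow>
      (x, v) \<in> state_space \<Longrightarrow>
      (LINT \<omega>|P (x, v). exp (u * of_real (X t \<omega>) + w * of_real (V t \<omega>)))
        = exp (\<phi> t u w + \<psi> t u w * of_real v + u * of_real x)"
    and admissible: "admissible C"
    and riccati_init: "\<phi> 0 u w = 0" "\<psi> 0 u w = w"
    and riccati_F: "0 \<le> s \<Longrightarrow> s \<le> t \<Longrightarrow> 0 < t \<Longrightarrow>
      (\<forall>r\<in>{0..t}. \<forall>z\<in>state_space.
        integrable (P z) (\<lambda>\<omega>. exp (u * of_real (X r \<omega>) + w * of_real (V r \<omega>)))) \<Longrightarrow>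
      F_defined C u (\<psi> s u w) \<Longrightarrow>
      ((\<lambda>r. \<phi> r u w) has_vector_derivative F_complex C u (\<psi> s u w)) (at s within {0..t})"
    and riccati_R: "0 \<le> s \<Longrightarrow> s \<le> t \<Longrightarrow> 0 < t \<Longrightarrow>
      (\<forall>r\<in>{0..t}. \<forall>z\<in>state_space.
        integrable (P z) (\<lambda>\<omega>. exp (u * of_real (X r \<omega>) + w * of_real (V r \<omega>)))) \<Longrightarrow>
      R_defined C u (\<psi> s u w) \<Longrightarrow>
      ((\<lambda>r. \<psi> r u w) has_vector_derivative R_complex C u (\<psi> s u w)) (at s within {0..t})"

section \<open>Equilibria and the long-time exponent\<close>

definition autonomous_solution :: "(real \<Rightarrow> ereal) \<Rightarrow> (real \<Rightarrow> real) \<Rightarrow> bool" where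
  "autonomous_solution f y \<longleftrightarrow>
     (\<forall>t\<ge>0. \<exists>d. (y has_real_derivative d) (at t within {0..}) \<and> f (y t) = ereal d)"

definition equilibrium :: "(real \<Rightarrow> ereal) \<Rightarrow> real \<Rightarrow> bool" where
  "equilibrium f w \<longleftrightarrow> f w = 0"

text \<open>Attraction is required from below only. \<open>R u\<close> may be infinite immediately above the
  equilibrium, and at an endpoint of \<open>I\<close> the two equilibria may merge into a double root (as in the
  Heston model), which attracts from below but not from above and still counts as the stable one.\<close>

definition stable_equilibrium :: "(real \<Rightarrow> ereal) \<Rightarrow> real \<Rightarrow> bool" where
  "stable_equilibrium f w \<longleftrightarrow> equilibrium f w \<and>
     (\<exists>\<delta>>0. \<forall>v\<in>{w - \<delta><..w}.
        (\<exists>y. autonomous_solution f y \<and> y 0 = v) \<and>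
        (\<forall>y. autonomous_solution f y \<and> y 0 = v \<longrightarrow> (y \<longlongrightarrow> w) at_top))"

definition other_equilibrium :: "(real \<Rightarrow> ereal) \<Rightarrow> real \<Rightarrow> ereal" where
  "other_equilibrium f w =
     (if \<exists>v. equilibrium f v \<and> v \<noteq> w then ereal (THE v. equilibrium f v \<and> v \<noteq> w) else \<infinity>)"

definition exponent_domain :: "characteristics \<Rightarrow> real set \<Rightarrow> (real \<Rightarrow> real) \<Rightarrow> real set" where
  "exponent_domain C I w = {u \<in> I. F_real C u (w u) < \<infinity>}"

definition exponent :: "characteristics \<Rightarrow> real set \<Rightarrow> (real \<Rightarrow> real) \<Rightarrow> real \<Rightarrow> ereal" where
  "exponent C I w u = (if u \<in> exponent_domain C I w then F_real C u (w u) else \<infinity>)"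

definition essentially_smooth :: "(real \<Rightarrow> ereal) \<Rightarrow> bool" where
  "essentially_smooth f \<longleftrightarrow>
     (let D = {u. f u < \<infinity>}; g = (\<lambda>u. real_of_ereal (f u)) in
      interior D \<noteq> {} \<and>
      (\<forall>u\<in>interior D. g differentiable (at u)) \<and>
      (\<forall>s c. (\<forall>n. s n \<in> interior D) \<and> s \<longlonglongrightarrow> c \<and> c \<in> frontier D
         \<longrightarrow> filterlim (\<lambda>n. \<bar>deriv g (s n)\<bar>) at_top sequentially))"

locale standing_assumptions = affine_stochastic_volatility S P X V \<phi> \<psi> C
  for S :: "'w measure" and P :: "real \<times> real \<Rightarrow> 'w measure" and X V :: "real \<Rightarrow> 'w \<Rightarrow> real"
    and \<phi> \<psi> :: "real \<Rightarrow> complex \<Rightarrow> complex \<Rightarrow> complex" and C :: characteristics +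
  fixes v0 :: real and I :: "real set" and w :: "real \<Rightarrow> real"
  assumes v0_nonneg: "0 \<le> v0"
    and R_nontrivial: "\<exists>u. R_real C u 0 \<noteq> 0"
    and F_one: "F_real C 1 0 = 0"
    and R_one: "R_real C 1 0 = 0"
    and chi_finite: "chi C 0 + chi C 1 < \<infinity>"
    and chi_neg: "chi C 0 < 0" "chi C 1 < 0"
    and I_interval: "is_interval I" "{0..1} \<subseteq> I"
    and w_stable: "u \<in> I \<Longrightarrow> stable_equilibrium (R_real C u) (w u)"
    and w_unique: "u \<in> I \<Longrightarrow> stable_equilibrium (R_real C u) v \<Longrightarrow> v = w u"
    and one_other: "u \<in> I \<Longrightarrow> equilibrium (R_real C u) v \<Longrightarrow> equilibrium (R_real C u) v' \<Longrightarrow>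
      v \<noteq> w u \<Longrightarrow> v' \<noteq> w u \<Longrightarrow> v = v'"
    and no_equilibrium: "u \<notin> I \<Longrightarrow> \<not> equilibrium (R_real C u) v"
    and finite_left: "\<exists>u<0. exponent C I w u < \<infinity>"
    and ess_smooth: "essentially_smooth (exponent C I w)"

section \<open>The rate function\<close>

definition path_rate :: "real set \<Rightarrow> (real \<Rightarrow> ereal) \<Rightarrow> real \<Rightarrow> (real \<Rightarrow> real) \<Rightarrow> ereal" where
  "path_rate J h T x =
     Sup {(\<Sum>j=1..n. ereal (\<Theta> j * (x (t j) - x (t (j - 1))))) -
            (\<Sum>j=1..n. ereal (t j - t (j - 1)) * h (\<Theta> j)) | n t \<Theta>.
          1 \<le> n \<and> t 0 = 0 \<and> (\<forall>j<n. t j < t (Suc j)) \<and> t n \<le> T \<and> (\<forall>j\<in>{1..n}. \<Theta> j \<in> J)}"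

definition conjugate :: "real set \<Rightarrow> (real \<Rightarrow> ereal) \<Rightarrow> real \<Rightarrow> ereal" where
  "conjugate J h y = (SUP \<theta>\<in>J. ereal (\<theta> * y) - h \<theta>)"

definition recession :: "real set \<Rightarrow> (real \<Rightarrow> ereal) \<Rightarrow> real \<Rightarrow> ereal" where
  "recession J h y = Lim (at_right 0) (\<lambda>\<epsilon>. ereal \<epsilon> * conjugate J h (y / \<epsilon>))"

definition ereal_integral :: "'a measure \<Rightarrow> ('a \<Rightarrow> ereal) \<Rightarrow> ereal" where
  "ereal_integral M f =
     enn2ereal (\<integral>\<^sup>+ t. e2ennreal (f t) \<partial>M) - enn2ereal (\<integral>\<^sup>+ t. e2ennreal (- f t) \<partial>M)"

definition has_bounded_variation :: "real \<Rightarrow> (real \<Rightarrow> real) \<Rightarrow> bool" where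
  "has_bounded_variation T x \<longleftrightarrow>
     (\<exists>B. \<forall>n (t :: nat \<Rightarrow> real).
        0 \<le> t 0 \<and> (\<forall>j<n. t j \<le> t (Suc j)) \<and> t n \<le> T \<longrightarrow>
        (\<Sum>j<n. \<bar>x (t (Suc j)) - x (t j)\<bar>) \<le> B)"

abbreviation lebesgue_upto :: "real \<Rightarrow> real measure" where
  "lebesgue_upto T \<equiv> restrict_space lborel {0..T}"

definition signed_measure :: "'a measure \<Rightarrow> ('a set \<Rightarrow> real) \<Rightarrow> bool" where
  "signed_measure M \<nu> \<longleftrightarrow> \<nu> {} = 0 \<and>
     (\<forall>A :: nat \<Rightarrow> 'a set. range A \<subseteq> sets M \<and> disjoint_family A
        \<longrightarrow> (\<lambda>i. \<nu> (A i)) sums \<nu> (\<Union>i. A i))"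

text \<open>The measure \<open>dx\<close> associated with \<open>x\<close> on \<open>[0,T]\<close>. The usual conventions
  \<open>x t - x 0 = dx [0,t]\<close> (right-continuous paths) and \<open>x t - x 0 = dx [0,t)\<close> (left-continuous paths)
  are both covered: the value at a jump time may be any point between the one-sided limits. The
  condition forces \<open>x (t+) - x 0 = dx [0,t]\<close> and hence determines \<open>dx\<close>. A path of bounded variation
  whose value at some interior time lies outside the segment between the one-sided limits (such as the
  indicator function of a point) is not represented by any measure on \<open>[0,T]\<close> in this sense.\<close>

definition path_measure :: "real \<Rightarrow> (real \<Rightarrow> real) \<Rightarrow> (real set \<Rightarrow> real) \<Rightarrow> bool" where
  "path_measure T x dx \<longleftrightarrow>
     signed_measure (lebesgue_upto T) dx \<and>
     (\<forall>t\<in>{0..<T}. x t - x 0 \<in> closed_segment (dx {0..<t}) (dx {0..t})) \<and>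
     x T - x 0 = dx {0..T}"

definition singular_to :: "'a measure \<Rightarrow> ('a set \<Rightarrow> real) \<Rightarrow> bool" where
  "singular_to M \<nu> \<longleftrightarrow> (\<exists>N\<in>null_sets M. \<forall>A\<in>sets M. A \<inter> N = {} \<longrightarrow> \<nu> A = 0)"

definition abs_continuous_wrt :: "'a measure \<Rightarrow> ('a set \<Rightarrow> real) \<Rightarrow> bool" where
  "abs_continuous_wrt M \<nu> \<longleftrightarrow> (\<forall>A\<in>null_sets M. \<nu> A = 0)"

definition is_density :: "'a measure \<Rightarrow> ('a set \<Rightarrow> real) \<Rightarrow> ('a \<Rightarrow> real) \<Rightarrow> bool" where
  "is_density M \<nu> g \<longleftrightarrow> integrable M g \<and> (\<forall>A\<in>sets M. \<nu> A = (LINT t:A|M. g t))"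

text \<open>\<open>dx = xdot dt + \<nu>\<close> with \<open>\<nu>\<close> singular; the absolutely continuous part of \<open>x\<close> is
  the indefinite integral of \<open>xdot\<close>, whose derivative is \<open>xdot\<close> almost everywhere.\<close>

definition lebesgue_decomposition ::
    "real \<Rightarrow> (real set \<Rightarrow> real) \<Rightarrow> (real \<Rightarrow> real) \<Rightarrow> (real set \<Rightarrow> real) \<Rightarrow> bool" where
  "lebesgue_decomposition T dx xdot \<nu> \<longleftrightarrow>
     signed_measure (lebesgue_upto T) \<nu> \<and> singular_to (lebesgue_upto T) \<nu> \<and>
     is_density (lebesgue_upto T) (\<lambda>A. dx A - \<nu> A) xdot"

end

theory Submission
  imports Defs
begin

text \<open>
  The identity rests on four properties of the limiting exponent \<open>h\<close> on its domain \<open>J\<close>: it is finite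
  there, \<open>h 0 = 0\<close>, it is bounded below, and \<open>J\<close> contains numbers of both signs.

  These properties come from the Riccati equations. Write \<open>\<chi>\<close> for \<open>chi\<close>. For \<open>m = 0\<close> and \<open>m = 1\<close>
  the convex function \<open>R(m, \<cdot>)\<close> vanishes at \<open>0\<close> with slope \<open>\<chi>(m) < 0\<close>, so it is positive on the
  negative half-line, and attraction from below forces \<open>w(m) = 0\<close>; hence \<open>h(0) = h(1) = 0\<close>. If \<open>m\<close> is a
  convex combination of \<open>u\<close> and \<open>u'\<close> in \<open>J\<close>, joint convexity of \<open>R\<close> together with the tangent of
  \<open>R(m, \<cdot>)\<close> at \<open>0\<close> makes the same combination of \<open>w(u)\<close> and \<open>w(u')\<close> nonnegative. As \<open>F\<close> is jointly
  convex and increasing in its second argument, that combination of \<open>h(u)\<close> and \<open>h(u')\<close> is then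
  nonnegative too (\<open>exponent_combination_nonneg\<close>). With a point \<open>a < 0\<close> of \<open>J\<close> at hand, these
  three-point inequalities bound \<open>h\<close> from below on all of \<open>J\<close> (\<open>exponent_lower\<close>).

  The rest is a duality argument for an arbitrary cost with the four properties. The rate function is
  the best profit of an investor who holds \<open>\<theta> \<in> J\<close> units of \<open>x\<close> at the running cost \<open>h \<theta>\<close> and may
  change \<open>\<theta>\<close> finitely often. If \<open>x\<close> has unbounded variation, buying before each rise and selling
  short before each fall earns an unbounded profit at bounded cost. Otherwise the profit is an
  integral against \<open>dt\<close> and the singular part \<open>\<nu>\<close>. A position \<open>\<theta>\<close> earns at most
  \<open>h\<^sup>*(xdot t)\<close> per unit of time and at most the support function of \<open>J\<close> at \<open>g t\<close>
  on \<open>\<nu>\<close>, where running costs are invisible because \<open>\<nu>\<close> lives on a Lebesgue null set. As \<open>h\<close> is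
  bounded below, that support function is the recession function of \<open>h\<^sup>*\<close>
  (\<open>recession_eq_support\<close>); this gives one inequality (\<open>strategy_le_integrals\<close>).
  For the converse (\<open>integrals_le_path_rate\<close>), a countable family of positions reproduces both
  suprema; the best among its first \<open>n\<close> members, chosen separately on the null set and off it, is a
  measurable simple function of time whose profit increases to the right-hand side, and step functions
  that switch at times which are not atoms of \<open>dx\<close> approximate it (\<open>gain_le_path_rate\<close>).
\<close>

section \<open>Convexity of the Levy--Khintchine exponents\<close>

definition real_integrand :: "(real \<times> real \<Rightarrow> real^2) \<Rightarrow> real \<Rightarrow> real \<Rightarrow> real \<times> real \<Rightarrow> real" where
  "real_integrand tr u w p = exp (fst p * u + snd p * w) - 1 - (tr p $ 1 * u + tr p $ 2 * w)"

definition quadratic_form :: "real^2^2 \<Rightarrow> real \<Rightarrow> real \<Rightarrow> real" where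
  "quadratic_form A u w = A $ 1 $ 1 * u * u + A $ 1 $ 2 * u * w + A $ 2 $ 1 * w * u + A $ 2 $ 2 * w * w"

definition real_exponent ::
    "(real \<times> real \<Rightarrow> real^2) \<Rightarrow> real^2^2 \<Rightarrow> real^2 \<Rightarrow> (real \<times> real) measure \<Rightarrow> real \<Rightarrow> real \<Rightarrow> real"
  where
  "real_exponent tr A b m u w =
     quadratic_form A u w / 2 + (b $ 1 * u + b $ 2 * w) +
     (LINT p:(state_space - {0})|m. real_integrand tr u w p)"

lemma lk_integrand_of_real:
  "lk_integrand tr (vector [of_real u, of_real w]) p = of_real (real_integrand tr u w p)"
  by (simp add: lk_integrand_def real_integrand_def cdot_def sum_2 exp_of_real flip: of_real_mult of_real_add)

lemma lk_defined_of_real: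
  "lk_defined tr m (of_real u) (of_real w) \<longleftrightarrow> set_integrable m (state_space - {0}) (real_integrand tr u w)"
proof -
  have "(\<lambda>p. indicator (state_space - {0}) p *\<^sub>R complex_of_real (real_integrand tr u w p)) =
      (\<lambda>p. complex_of_real (indicator (state_space - {0}) p *\<^sub>R real_integrand tr u w p))"
    by (auto simp: scaleR_conv_of_real)
  then show ?thesis
    unfolding lk_defined_def set_integrable_def lk_integrand_of_real
    by (simp only: complex_of_real_integrable_eq)
qed

lemma lk_exponent_of_real:
  "Re (lk_exponent tr A b m (of_real u) (of_real w)) = real_exponent tr A b m u w"
  unfolding lk_exponent_def real_exponent_def lk_integrand_of_real set_integral_complex_of_real
  by (simp add: cquad_def cdot_def sum_2 quadratic_form_def algebra_simps)

lemma F_real_eq: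
  "F_real C u w = (if set_integrable (jump_F C) (state_space - {0}) (real_integrand trunc_F u w)
     then ereal (real_exponent trunc_F (diff_F C) (drift_F C) (jump_F C) u w) else \<infinity>)"
  by (simp only: F_real_def F_defined_def F_complex_def lk_defined_of_real lk_exponent_of_real)

lemma R_real_eq:
  "R_real C u w = (if set_integrable (jump_R C) (state_space - {0}) (real_integrand trunc_R u w)
     then ereal (real_exponent trunc_R (diff_R C) (drift_R C) (jump_R C) u w) else \<infinity>)"
  by (simp only: R_real_def R_defined_def R_complex_def lk_defined_of_real lk_exponent_of_real)

lemma F_real_zero: "F_real C 0 0 = 0" and R_real_zero: "R_real C 0 0 = 0"
  by (simp_all add: F_real_eq R_real_eq real_exponent_def quadratic_form_def real_integrand_def set_integrable_def)

lemma real_integrand_convex: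
  assumes "0 \<le> s" "s \<le> 1"
  shows "real_integrand tr (s * u1 + (1 - s) * u2) (s * w1 + (1 - s) * w2) p \<le>
    s * real_integrand tr u1 w1 p + (1 - s) * real_integrand tr u2 w2 p"
  using convex_onD[OF exp_convex, of "1 - s" "fst p * u1 + snd p * w1" "fst p * u2 + snd p * w2"] assms
  by (simp add: real_integrand_def algebra_simps)

lemma quadratic_form_nonneg: "pos_semidef A \<Longrightarrow> 0 \<le> quadratic_form A u w"
proof -
  assume "pos_semidef A"
  then have "0 \<le> vector [u, w] \<bullet> (A *v vector [u, w] :: real^2)"
    unfolding pos_semidef_def by blast
  then show ?thesis
    by (simp add: quadratic_form_def inner_vec_def matrix_vector_mult_def sum_2 algebra_simps)
qed

text \<open>The gap between the two sides is \<open>s (1 - s)\<close> times the form at the difference of the two points.\<close>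

lemma quadratic_form_convex:
  assumes "pos_semidef A" "0 \<le> s" "s \<le> 1"
  shows "quadratic_form A (s * u1 + (1 - s) * u2) (s * w1 + (1 - s) * w2) \<le>
    s * quadratic_form A u1 w1 + (1 - s) * quadratic_form A u2 w2"
proof -
  have "0 \<le> s * (1 - s) * quadratic_form A (u1 - u2) (w1 - w2)"
    using assms quadratic_form_nonneg[of A] by simp
  also have "\<dots> = s * quadratic_form A u1 w1 + (1 - s) * quadratic_form A u2 w2
      - quadratic_form A (s * u1 + (1 - s) * u2) (s * w1 + (1 - s) * w2)"
    by (simp add: quadratic_form_def algebra_simps)
  finally show ?thesis by simp
qed

lemma exponent_sum_le:
  fixes Q Q1 Q2 B B1 B2 L L1 L2 s :: real
  assumes "Q \<le> s * Q1 + (1 - s) * Q2" "B \<le> s * B1 + (1 - s) * B2" "L \<le> s * L1 + (1 - s) * L2"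
  shows "Q / 2 + B + L \<le> s * (Q1 / 2 + B1 + L1) + (1 - s) * (Q2 / 2 + B2 + L2)"
proof -
  have "s * (Q1 / 2 + B1 + L1) + (1 - s) * (Q2 / 2 + B2 + L2) =
      (s * Q1 + (1 - s) * Q2) / 2 + (s * B1 + (1 - s) * B2) + (s * L1 + (1 - s) * L2)"
    by (simp add: field_simps)
  then show ?thesis using assms by (simp only:) (intro add_mono divide_right_mono, simp_all)
qed

lemma state_space_measurable [measurable]: "state_space - {0} \<in> sets (borel :: (real \<times> real) measure)"
proof -
  have "closed state_space" unfolding state_space_def by (intro closed_Times) auto
  then show ?thesis by (intro sets.Diff) auto
qed

lemma real_integrand_measurable:
  assumes "sets m = sets borel" "tr = trunc_F \<or> tr = trunc_R"
  shows "real_integrand tr u w \<in> borel_measurable m"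
proof -
  have "real_integrand tr u w \<in> borel_measurable borel"
    using assms(2) unfolding real_integrand_def trunc_F_def trunc_R_def borel_prod[symmetric] by auto
  then show ?thesis using measurable_cong_sets[OF assms(1) refl] by blast
qed

text \<open>The tangent of \<open>R(u, \<cdot>)\<close> at \<open>0\<close> has slope \<open>chi C u\<close>. The inequality \<open>exp z - 1 \<ge> z\<close>, applied to
  \<open>z = y v\<close> under the integral, avoids differentiating the integral.\<close>

lemma R_real_tangent:
  assumes adm: "admissible C" and chi: "chi C u = ereal c" and R0: "R_real C u 0 = 0"
  shows "ereal (c * v) \<le> R_real C u v"
proof (cases "set_integrable (jump_R C) (state_space - {0}) (real_integrand trunc_R u v)")
  case False
  then show ?thesis by (simp add: R_real_eq)
next
  case True
  let ?S = "state_space - {0} :: (real \<times> real) set" and ?m = "jump_R C"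
  define f where "f = (\<lambda>p :: real \<times> real. snd p * (exp (fst p * u) - 1 / (1 + (snd p)\<^sup>2)))"
  have f: "set_integrable ?m ?S f" and c: "c = diff_R C $ 1 $ 2 * u + drift_R C $ 2 + (LINT p:?S|?m. f p)"
    using chi unfolding chi_def f_def[symmetric] Let_def by (auto split: if_splits)
  have k0: "set_integrable ?m ?S (real_integrand trunc_R u 0)"
    and e0: "real_exponent trunc_R (diff_R C) (drift_R C) ?m u 0 = 0"
    using R0 by (auto simp: R_real_eq zero_ereal_def split: if_splits)
  have fv: "set_integrable ?m ?S (\<lambda>p. v * f p)" using f by simp
  have "(LINT p:?S|?m. real_integrand trunc_R u 0 p + v * f p) \<le> (LINT p:?S|?m. real_integrand trunc_R u v p)"
  proof (rule set_integral_mono[OF set_integral_add(1)[OF k0 fv] True])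
    fix p :: "real \<times> real"
    have "snd p * v \<le> exp (snd p * v) - 1"
      using exp_ge_add_one_self[of "snd p * v"] by linarith
    then have "exp (fst p * u) * (snd p * v) \<le> exp (fst p * u) * (exp (snd p * v) - 1)"
      by (intro mult_left_mono) auto
    then show "real_integrand trunc_R u 0 p + v * f p \<le> real_integrand trunc_R u v p"
      by (simp add: real_integrand_def f_def trunc_R_def exp_add algebra_simps)
  qed
  then have int: "(LINT p:?S|?m. real_integrand trunc_R u 0 p) + v * (LINT p:?S|?m. f p)
      \<le> (LINT p:?S|?m. real_integrand trunc_R u v p)"
    by (simp add: set_integral_add(2)[OF k0 fv])
  have psd: "pos_semidef (diff_R C)" using adm by (simp add: admissible_def)
  then have sym: "diff_R C $ 2 $ 1 = diff_R C $ 1 $ 2"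
  proof -
    have "transpose (diff_R C) $ 1 $ 2 = diff_R C $ 1 $ 2" using psd by (simp add: pos_semidef_def)
    then show ?thesis by (simp add: transpose_def)
  qed
  have "0 \<le> quadratic_form (diff_R C) 0 v" by (rule quadratic_form_nonneg[OF psd])
  moreover have "quadratic_form (diff_R C) u v =
      quadratic_form (diff_R C) u 0 + 2 * (diff_R C $ 1 $ 2 * u * v) + quadratic_form (diff_R C) 0 v"
    by (simp add: quadratic_form_def sym algebra_simps)
  ultimately have "c * v \<le> real_exponent trunc_R (diff_R C) (drift_R C) ?m u v"
    using int e0
    by (simp add: real_exponent_def c algebra_simps add_divide_distrib)
  with True show ?thesis by (simp add: R_real_eq)
qed

text \<open>Convexity is clear where the integrals converge; what has to be shown is that the integral at the
  intermediate point converges. The integrand there is dominated from above by the convex combination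
  and from below by its tangent in \<open>w\<close>, which is integrable because \<open>chi C u\<close> and \<open>R_real C u 0\<close> are
  finite.\<close>

lemma R_real_convex:
  assumes adm: "admissible C" and s: "0 \<le> s" "s \<le> 1"
    and R1: "R_real C u1 w1 = ereal r1" and R2: "R_real C u2 w2 = ereal r2"
    and u: "u = s * u1 + (1 - s) * u2" and w: "w = s * w1 + (1 - s) * w2"
    and chi: "chi C u < \<infinity>" and R0: "R_real C u 0 = 0"
  shows "R_real C u w \<le> ereal (s * r1 + (1 - s) * r2)"
proof -
  let ?S = "state_space - {0} :: (real \<times> real) set" and ?m = "jump_R C"
  let ?k = "real_integrand trunc_R"
  have sets: "sets ?m = sets borel" using adm by (simp add: admissible_def levy_measure_def)
  define f where "f = (\<lambda>p :: real \<times> real. snd p * (exp (fst p * u) - 1 / (1 + (snd p)\<^sup>2)))"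
  have f: "set_integrable ?m ?S f"
    using chi unfolding chi_def f_def[symmetric] Let_def by (auto split: if_splits)
  have k0: "set_integrable ?m ?S (?k u 0)"
    using R0 by (auto simp: R_real_eq zero_ereal_def split: if_splits)
  have k1: "set_integrable ?m ?S (?k u1 w1)" and e1: "real_exponent trunc_R (diff_R C) (drift_R C) ?m u1 w1 = r1"
    using R1 by (auto simp: R_real_eq split: if_splits)
  have k2: "set_integrable ?m ?S (?k u2 w2)" and e2: "real_exponent trunc_R (diff_R C) (drift_R C) ?m u2 w2 = r2"
    using R2 by (auto simp: R_real_eq split: if_splits)
  have upper: "?k u w p \<le> s * ?k u1 w1 p + (1 - s) * ?k u2 w2 p" for p
    unfolding u w by (rule real_integrand_convex[OF s])
  have lower: "?k u 0 p + w * f p \<le> ?k u w p" for p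
  proof -
    have "snd p * w \<le> exp (snd p * w) - 1"
      using exp_ge_add_one_self[of "snd p * w"] by linarith
    then have "exp (fst p * u) * (snd p * w) \<le> exp (fst p * u) * (exp (snd p * w) - 1)"
      by (intro mult_left_mono) auto
    then show ?thesis
      by (simp add: real_integrand_def f_def trunc_R_def exp_add algebra_simps)
  qed
  have s1: "set_integrable ?m ?S (\<lambda>p. s * ?k u1 w1 p)" and s2: "set_integrable ?m ?S (\<lambda>p. (1 - s) * ?k u2 w2 p)"
    using k1 k2 by simp_all
  have comb: "set_integrable ?m ?S (\<lambda>p. s * ?k u1 w1 p + (1 - s) * ?k u2 w2 p)"
    by (rule set_integral_add(1)[OF s1 s2])
  have low: "set_integrable ?m ?S (\<lambda>p. ?k u 0 p + w * f p)"
    using f by (intro set_integral_add(1)[OF k0]) simp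
  have k: "set_integrable ?m ?S (?k u w)"
  proof (rule set_integrable_bound[OF set_integral_add(1)[OF set_integrable_abs[OF comb] set_integrable_abs[OF low]]])
    show "set_borel_measurable ?m ?S (?k u w)"
      unfolding set_borel_measurable_def
      using real_integrand_measurable[OF sets, of trunc_R u w] state_space_measurable
      by (intro borel_measurable_scaleR borel_measurable_indicator) (auto simp: sets)
    show "AE p in ?m. p \<in> ?S \<longrightarrow> norm (?k u w p) \<le>
        norm (\<bar>s * ?k u1 w1 p + (1 - s) * ?k u2 w2 p\<bar> + \<bar>?k u 0 p + w * f p\<bar>)"
      using upper lower by (intro AE_I2 impI) (smt (verit) real_norm_def)
  qed
  have "(LINT p:?S|?m. ?k u w p) \<le> (LINT p:?S|?m. s * ?k u1 w1 p + (1 - s) * ?k u2 w2 p)"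
    using upper by (intro set_integral_mono[OF k comb])
  then have "(LINT p:?S|?m. ?k u w p) \<le> s * (LINT p:?S|?m. ?k u1 w1 p) + (1 - s) * (LINT p:?S|?m. ?k u2 w2 p)"
    by (simp add: set_integral_add(2)[OF s1 s2])
  moreover have "quadratic_form (diff_R C) u w \<le>
      s * quadratic_form (diff_R C) u1 w1 + (1 - s) * quadratic_form (diff_R C) u2 w2"
    unfolding u w using adm by (intro quadratic_form_convex s) (simp add: admissible_def)
  moreover have "drift_R C $ 1 * u + drift_R C $ 2 * w \<le>
      s * (drift_R C $ 1 * u1 + drift_R C $ 2 * w1) + (1 - s) * (drift_R C $ 1 * u2 + drift_R C $ 2 * w2)"
    by (simp add: u w algebra_simps)
  ultimately have "real_exponent trunc_R (diff_R C) (drift_R C) ?m u w \<le> s * r1 + (1 - s) * r2"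
    unfolding e1[symmetric] e2[symmetric] real_exponent_def by (intro exponent_sum_le)
  with k show ?thesis by (simp add: R_real_eq)
qed

text \<open>\<open>F\<close> increases in its second argument, since jumps in that direction are nonnegative and enter
  without compensation and the drift in it is nonnegative. So \<open>F(u, 0) = 0\<close> lies below the value of
  \<open>F\<close> at the combination, which lies below the combination of the values. Comparing the integrands
  of the outer terms directly spares the question whether \<open>F\<close> is finite in the middle.\<close>

lemma F_real_convex_lower:
  assumes adm: "admissible C" and s: "0 \<le> s" "s \<le> 1"
    and F1: "F_real C u1 w1 = ereal r1" and F2: "F_real C u2 w2 = ereal r2"
    and u: "u = s * u1 + (1 - s) * u2" and w: "0 \<le> s * w1 + (1 - s) * w2"
    and F0: "F_real C u 0 = 0"
  shows "0 \<le> s * r1 + (1 - s) * r2"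
proof -
  let ?S = "state_space - {0} :: (real \<times> real) set" and ?m = "jump_F C"
  let ?k = "real_integrand trunc_F" and ?w = "s * w1 + (1 - s) * w2"
  have k0: "set_integrable ?m ?S (?k u 0)" and e0: "real_exponent trunc_F (diff_F C) (drift_F C) ?m u 0 = 0"
    using F0 by (auto simp: F_real_eq zero_ereal_def split: if_splits)
  have k1: "set_integrable ?m ?S (?k u1 w1)" and e1: "real_exponent trunc_F (diff_F C) (drift_F C) ?m u1 w1 = r1"
    using F1 by (auto simp: F_real_eq split: if_splits)
  have k2: "set_integrable ?m ?S (?k u2 w2)" and e2: "real_exponent trunc_F (diff_F C) (drift_F C) ?m u2 w2 = r2"
    using F2 by (auto simp: F_real_eq split: if_splits)
  have s1: "set_integrable ?m ?S (\<lambda>p. s * ?k u1 w1 p)" and s2: "set_integrable ?m ?S (\<lambda>p. (1 - s) * ?k u2 w2 p)"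
    using k1 k2 by simp_all
  have "(LINT p:?S|?m. ?k u 0 p) \<le> (LINT p:?S|?m. s * ?k u1 w1 p + (1 - s) * ?k u2 w2 p)"
  proof (rule set_integral_mono[OF k0 set_integral_add(1)[OF s1 s2]])
    fix p :: "real \<times> real" assume "p \<in> ?S"
    then have "0 \<le> snd p" by (auto simp: state_space_def)
    then have "?k u 0 p \<le> ?k u ?w p" using w by (simp add: real_integrand_def trunc_F_def)
    also have "\<dots> \<le> s * ?k u1 w1 p + (1 - s) * ?k u2 w2 p"
      unfolding u by (rule real_integrand_convex[OF s])
    finally show "?k u 0 p \<le> s * ?k u1 w1 p + (1 - s) * ?k u2 w2 p" .
  qed
  then have "(LINT p:?S|?m. ?k u 0 p) \<le> s * (LINT p:?S|?m. ?k u1 w1 p) + (1 - s) * (LINT p:?S|?m. ?k u2 w2 p)"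
    by (simp add: set_integral_add(2)[OF s1 s2])
  moreover have "quadratic_form (diff_F C) u 0 \<le>
      s * quadratic_form (diff_F C) u1 w1 + (1 - s) * quadratic_form (diff_F C) u2 w2"
  proof -
    have "quadratic_form (diff_F C) u ?w \<le>
        s * quadratic_form (diff_F C) u1 w1 + (1 - s) * quadratic_form (diff_F C) u2 w2"
      unfolding u using adm by (intro quadratic_form_convex s) (simp add: admissible_def)
    then show ?thesis using adm by (simp add: quadratic_form_def admissible_def)
  qed
  moreover have "drift_F C $ 1 * u + drift_F C $ 2 * 0 \<le>
      s * (drift_F C $ 1 * u1 + drift_F C $ 2 * w1) + (1 - s) * (drift_F C $ 1 * u2 + drift_F C $ 2 * w2)"
  proof -
    have "0 \<le> drift_F C $ 2 * ?w"
      using adm w by (intro mult_nonneg_nonneg) (auto simp: admissible_def state_space_def)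
    then show ?thesis by (simp add: u algebra_simps)
  qed
  ultimately have "real_exponent trunc_F (diff_F C) (drift_F C) ?m u 0 \<le> s * r1 + (1 - s) * r2"
    unfolding e1[symmetric] e2[symmetric] real_exponent_def by (intro exponent_sum_le)
  with e0 show ?thesis by simp
qed

section \<open>The exponent of the model is bounded below\<close>

text \<open>A path that climbs from \<open>a\<close> to \<open>b\<close> has positive slope somewhere strictly between these levels:
  apply the mean value theorem between the first visit to \<open>b\<close> and the last visit to \<open>a\<close> before it.\<close>

lemma increasing_crossing:
  fixes y :: "real \<Rightarrow> real"
  assumes d: "\<And>t. 0 \<le> t \<Longrightarrow> (y has_real_derivative d t) (at t within {0..})"
    and T: "0 \<le> T" and low: "y 0 \<le> a" and ab: "a < b" and high: "b \<le> y T"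
  shows "\<exists>t\<ge>0. a < y t \<and> y t < b \<and> 0 < d t"
proof -
  have cont: "continuous_on {0..} y"
    using d by (auto simp: continuous_on_eq_continuous_within intro!: DERIV_continuous)
  have clA: "closed ({0..T} \<inter> y -` {b..})"
    by (intro continuous_closed_preimage continuous_on_subset[OF cont]) auto
  define q where "q = Inf ({0..T} \<inter> y -` {b..})"
  have q: "q \<in> {0..T} \<inter> y -` {b..}"
    unfolding q_def using T high by (intro closed_contains_Inf clA bdd_belowI[of _ 0]) auto
  have below: "y t < b" if "0 \<le> t" "t < q" for t
  proof (rule ccontr)
    assume "\<not> y t < b"
    then have "q \<le> t" unfolding q_def using that q by (intro cInf_lower bdd_belowI[of _ 0]) auto
    with that show False by simp
  qed
  have clB: "closed ({0..q} \<inter> y -` {..a})"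
    using q by (intro continuous_closed_preimage continuous_on_subset[OF cont]) auto
  define p where "p = Sup ({0..q} \<inter> y -` {..a})"
  have p: "p \<in> {0..q} \<inter> y -` {..a}"
    unfolding p_def using q low by (intro closed_contains_Sup clB bdd_aboveI[of _ q]) auto
  have above: "a < y t" if "p < t" "t \<le> q" for t
  proof (rule ccontr)
    assume "\<not> a < y t"
    then have "t \<le> p" unfolding p_def using that p by (intro cSup_upper bdd_aboveI[of _ q]) auto
    with that show False by simp
  qed
  have "p < q" using p q ab by (cases "p = q") auto
  have "\<exists>t\<in>{p<..<q}. y q - y p = (\<lambda>z. d t * z) (q - p)"
    using p by (intro mvt_simple[OF \<open>p < q\<close>] has_field_derivative_imp_has_derivative
        DERIV_subset[OF d]) auto
  then obtain t where t: "p < t" "t < q" "y q - y p = d t * (q - p)" by auto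
  have "0 < d t * (q - p)" using p q ab t(3) by simp
  then have "0 < d t" using \<open>p < q\<close> by (simp add: zero_less_mult_iff)
  then show ?thesis using t p above[of t] below[of t] by (intro exI[of _ t]) auto
qed

text \<open>If the vector field were nonpositive on a nondegenerate interval below \<open>b\<close>, a solution starting
  there could not climb to \<open>b\<close>.\<close>

lemma stable_equilibrium_minimal:
  assumes stable: "stable_equilibrium f b" and "a \<le> b"
    and nonpos: "\<And>v. a \<le> v \<Longrightarrow> v \<le> b \<Longrightarrow> f v \<le> 0"
  shows "b = a"
proof (rule ccontr)
  assume "b \<noteq> a"
  with \<open>a \<le> b\<close> have ab: "a < b" by simp
  from stable obtain \<delta> where \<delta>: "0 < \<delta>" "\<forall>v\<in>{b - \<delta><..b}.
        (\<exists>y. autonomous_solution f y \<and> y 0 = v) \<and>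
        (\<forall>y. autonomous_solution f y \<and> y 0 = v \<longrightarrow> (y \<longlongrightarrow> b) at_top)"
    unfolding stable_equilibrium_def by blast
  define v where "v = max a (b - \<delta> / 2)"
  have v: "a \<le> v" "v < b" "v \<in> {b - \<delta><..b}" using ab \<delta>(1) by (auto simp: v_def)
  from \<delta>(2) v(3) obtain y where y: "autonomous_solution f y" "y 0 = v" "(y \<longlongrightarrow> b) at_top" by blast
  obtain d where d: "\<And>t. 0 \<le> t \<Longrightarrow> (y has_real_derivative d t) (at t within {0..})"
    "\<And>t. 0 \<le> t \<Longrightarrow> f (y t) = ereal (d t)"
    using y(1) unfolding autonomous_solution_def by metis
  \<comment> \<open>The midpoint is used as upper level so that the crossing stays strictly below \<open>b\<close>, where the
    sign of the vector field is known.\<close>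
  have "\<forall>\<^sub>F t in at_top. (v + b) / 2 < y t" using v(2) by (intro order_tendstoD(1)[OF y(3)]) simp
  then have "\<exists>t\<ge>0. (v + b) / 2 < y t" unfolding eventually_at_top_linorder by (meson max.cobounded1 max.cobounded2)
  then obtain T where "0 \<le> T" "(v + b) / 2 < y T" by blast
  then obtain t where t: "0 \<le> t" "v < y t" "y t < (v + b) / 2" "0 < d t"
    using increasing_crossing[OF d(1), of T v "(v + b) / 2"] y(2) v(2) by auto
  have "f (y t) \<le> 0" using t v by (intro nonpos) auto
  with d(2)[OF t(1)] t(4) show False by simp
qed

context standing_assumptions
begin

lemma chi_real:
  assumes "m \<in> {0, 1}"
  obtains c where "chi C m = ereal c" "c < 0"
proof -
  have "chi C m < 0" using assms chi_neg by auto
  moreover have "chi C m \<noteq> - \<infinity>" by (simp add: chi_def Let_def)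
  ultimately show ?thesis using that by (cases "chi C m") auto
qed

lemma R_zero_ends: "m \<in> {0, 1} \<Longrightarrow> R_real C m 0 = 0"
  using R_real_zero R_one by auto

lemma F_zero_ends: "m \<in> {0, 1} \<Longrightarrow> F_real C m 0 = 0"
  using F_real_zero F_one by auto

text \<open>\<open>R(m, \<cdot>)\<close> is nonpositive at the combination by convexity and at least \<open>chi C m\<close> times it by the
  tangent; \<open>chi C m < 0\<close>.\<close>

lemma equilibria_combination_nonneg:
  assumes m: "m \<in> {0, 1}" and s: "0 \<le> s" "s \<le> 1"
    and R1: "R_real C u1 w1 = 0" and R2: "R_real C u2 w2 = 0" and u: "m = s * u1 + (1 - s) * u2"
  shows "0 \<le> s * w1 + (1 - s) * w2"
proof -
  obtain c where c: "chi C m = ereal c" "c < 0" using chi_real[OF m] .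
  have "ereal (c * (s * w1 + (1 - s) * w2)) \<le> R_real C m (s * w1 + (1 - s) * w2)"
    by (rule R_real_tangent[OF admissible c(1) R_zero_ends[OF m]])
  also have "\<dots> \<le> ereal (s * 0 + (1 - s) * 0)"
    using R1 R2 c(1) by (intro R_real_convex[OF admissible s _ _ u refl _ R_zero_ends[OF m]]) (auto simp: zero_ereal_def)
  finally show ?thesis using c(2) by (simp add: mult_le_0_iff)
qed

text \<open>The equilibrium \<open>w m\<close> is nonnegative, and between \<open>0\<close> and \<open>w m\<close> the convex function
  \<open>R(m, \<cdot>)\<close> is nonpositive, so attraction from below leaves no room between them.\<close>

lemma w_ends:
  assumes m: "m \<in> {0, 1}"
  shows "m \<in> I" "w m = 0"
proof -
  show mI: "m \<in> I" using m I_interval(2) by auto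
  have R: "R_real C m (w m) = 0"
    using w_stable[OF mI] by (simp add: stable_equilibrium_def equilibrium_def)
  have nonneg: "0 \<le> w m"
    using equilibria_combination_nonneg[OF m, of 1 m "w m" m "w m"] R by simp
  show "w m = 0"
  proof (rule stable_equilibrium_minimal[OF w_stable[OF mI] nonneg])
    fix v assume v: "0 \<le> v" "v \<le> w m"
    obtain c where c: "chi C m = ereal c" using chi_real[OF m] .
    show "R_real C m v \<le> 0"
    proof (cases "w m = 0")
      case True
      with v R show ?thesis by simp
    next
      case False
      with v nonneg have s: "0 \<le> v / w m" "v / w m \<le> 1" by auto
      have "R_real C m v \<le> ereal (v / w m * 0 + (1 - v / w m) * 0)"
        using R R_zero_ends[OF m] c False
        by (intro R_real_convex[OF admissible s, of m "w m" _ m 0]) (auto simp: zero_ereal_def algebra_simps)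
      then show ?thesis by (simp add: zero_ereal_def)
    qed
  qed
qed

lemma ends_in_domain: "m \<in> {0, 1} \<Longrightarrow> m \<in> exponent_domain C I w"
  using w_ends F_zero_ends by (simp add: exponent_domain_def)

lemma exponent_real:
  assumes "u \<in> exponent_domain C I w"
  shows "exponent C I w u = ereal (real_of_ereal (exponent C I w u))"
proof -
  have "F_real C u (w u) \<noteq> - \<infinity>" by (simp add: F_real_def)
  moreover have "F_real C u (w u) < \<infinity>" using assms by (simp add: exponent_domain_def)
  ultimately show ?thesis using assms by (cases "F_real C u (w u)") (auto simp: exponent_def)
qed

lemma exponent_combination_nonneg:
  assumes m: "m \<in> {0, 1}" and s: "0 \<le> s" "s \<le> 1"
    and u1: "u1 \<in> exponent_domain C I w" and u2: "u2 \<in> exponent_domain C I w"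
    and u: "m = s * u1 + (1 - s) * u2"
  defines "k \<equiv> \<lambda>u. real_of_ereal (exponent C I w u)"
  shows "0 \<le> s * k u1 + (1 - s) * k u2"
proof -
  have I: "u1 \<in> I" "u2 \<in> I" using u1 u2 by (simp_all add: exponent_domain_def)
  have R: "R_real C u (w u) = 0" if "u \<in> I" for u
    using w_stable[OF that] by (simp add: stable_equilibrium_def equilibrium_def)
  have F: "F_real C u (w u) = ereal (k u)" if "u \<in> exponent_domain C I w" for u
    unfolding k_def exponent_real[OF that, symmetric] using that by (simp add: exponent_def)
  show ?thesis
    by (rule F_real_convex_lower[OF admissible s F[OF u1] F[OF u2] u _ F_zero_ends[OF m]])
      (rule equilibria_combination_nonneg[OF m s R[OF I(1)] R[OF I(2)] u])
qed

text \<open>Let \<open>a < 0\<close> be in the domain. Beyond \<open>1\<close> the exponent is nonnegative because \<open>1\<close> separates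
  the point from the zero at \<open>0\<close>; left of \<open>0\<close> because \<open>0\<close> separates it from the zero at \<open>1\<close>; on
  \<open>[0, 1]\<close> it lies above the line through \<open>(a, h a)\<close> and the origin.\<close>

lemma exponent_lower:
  obtains c where "\<And>u. u \<in> exponent_domain C I w \<Longrightarrow> - c \<le> real_of_ereal (exponent C I w u)"
proof -
  define k where "k = (\<lambda>u. real_of_ereal (exponent C I w u))"
  have k: "k 0 = 0" "k 1 = 0"
    using ends_in_domain w_ends F_zero_ends by (simp_all add: exponent_def k_def)
  have conv: "0 \<le> s * k u1 + (1 - s) * k u2"
    if "m \<in> {0, 1}" "0 \<le> s" "s \<le> 1" "u1 \<in> exponent_domain C I w" "u2 \<in> exponent_domain C I w"
      "m = s * u1 + (1 - s) * u2" for m s u1 u2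
    unfolding k_def using that by (rule exponent_combination_nonneg)
  obtain a where a: "a < 0" "exponent C I w a < \<infinity>" using finite_left by blast
  then have aD: "a \<in> exponent_domain C I w" by (auto simp: exponent_def split: if_splits)
  have 01: "0 \<in> exponent_domain C I w" "1 \<in> exponent_domain C I w" using ends_in_domain by auto
  have "- (\<bar>k a\<bar> / (- a)) \<le> k u" if u: "u \<in> exponent_domain C I w" for u
  proof -
    consider "1 < u" | "0 \<le> u" "u \<le> 1" | "u < 0" by linarith
    then have "0 \<le> k u \<or> - (\<bar>k a\<bar> / (- a)) \<le> k u"
    proof cases
      case 1
      then have "0 \<le> 1 / u * k u + (1 - 1 / u) * k 0"
        by (intro conv[of 1 "1 / u" u 0]) (use u 01 in auto)
      then show ?thesis using 1 k by (simp add: zero_le_divide_iff)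
    next
      case 2
      have D: "0 < u - a" using 2 a by simp
      have "0 \<le> u / (u - a) * k a + (1 - u / (u - a)) * k u"
        using 2 a by (intro conv[of 0 "u / (u - a)" a u]) (use u aD D in \<open>auto simp: field_simps\<close>)
      then have "0 \<le> (u - a) * (u / (u - a) * k a + (1 - u / (u - a)) * k u)" using D by simp
      also have "\<dots> = (u - a) * (u / (u - a)) * k a + ((u - a) - (u - a) * (u / (u - a))) * k u"
        by (simp only: ring_distribs mult.assoc mult_1)
      also have "\<dots> = u * k a + (- a) * k u" using D by simp
      finally have "- (u * k a) \<le> (- a) * k u" by simp
      moreover have "u * k a \<le> 1 * \<bar>k a\<bar>"
        using 2 mult_mono[of u 1 "\<bar>k a\<bar>" "\<bar>k a\<bar>"] mult_left_mono[of "k a" "\<bar>k a\<bar>" u] by linarith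
      ultimately have "- \<bar>k a\<bar> \<le> (- a) * k u" by linarith
      then show ?thesis using a by (simp add: field_simps)
    next
      case 3
      have D: "0 < 1 - u" using 3 by simp
      have "0 \<le> 1 / (1 - u) * k u + (1 - 1 / (1 - u)) * k 1"
        by (intro conv[of 0 "1 / (1 - u)" u 1]) (use u 01 D 3 in \<open>auto simp: field_simps\<close>)
      then show ?thesis using D k by (simp add: zero_le_divide_iff)
    qed
    moreover have "- (\<bar>k a\<bar> / (- a)) \<le> 0" using a by (simp add: divide_nonneg_neg)
    ultimately show ?thesis by linarith
  qed
  then show ?thesis using that unfolding k_def by blast
qed

end

section \<open>The rate function as a supremum over strategies\<close>

text \<open>\<open>strategy_value J k T x a v\<close>: a piecewise constant position with values in \<open>J\<close> can earn \<open>v\<close> from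
  the path \<open>x\<close> up to time \<open>a\<close>, net of the running cost \<open>k\<close>. Adding one holding period at a time
  turns statements about subdivisions into inductions.\<close>

inductive strategy_value :: "real set \<Rightarrow> (real \<Rightarrow> real) \<Rightarrow> real \<Rightarrow> (real \<Rightarrow> real) \<Rightarrow> real \<Rightarrow> real \<Rightarrow> bool"
  for J k T x where
  start: "strategy_value J k T x 0 0"
| advance: "strategy_value J k T x a v \<Longrightarrow> a < b \<Longrightarrow> b \<le> T \<Longrightarrow> \<theta> \<in> J \<Longrightarrow>
    strategy_value J k T x b (v + \<theta> * (x b - x a) - (b - a) * k \<theta>)"

lemma advance_weakly:
  assumes "strategy_value J k T x a v" "a \<le> b" "b \<le> T" "\<theta> \<in> J"
  shows "strategy_value J k T x b (v + \<theta> * (x b - x a) - (b - a) * k \<theta>)"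
  using assms advance[of J k T x a v b \<theta>] by (cases "a = b") auto

lemma strategy_value_time:
  assumes "strategy_value J k T x a v" "0 < T"
  shows "0 \<le> a \<and> a \<le> T"
  using assms by induction auto

lemma strategy_value_subdivision:
  assumes "strategy_value J k T x a v"
  shows "\<exists>n t \<Theta>. t 0 = 0 \<and> (\<forall>j<n. t j < t (Suc j)) \<and> t n = a \<and> (\<forall>j\<in>{1..n}. \<Theta> j \<in> J) \<and>
    v = (\<Sum>j=1..n. \<Theta> j * (x (t j) - x (t (j - 1)))) - (\<Sum>j=1..n. (t j - t (j - 1)) * k (\<Theta> j)) \<and>
    (n = 0 \<longrightarrow> v = 0)"
  using assms
proof induction
  case start
  show ?case by (rule exI[of _ 0], rule exI[of _ "\<lambda>_. 0"]) auto
next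
  case (advance a v b \<theta>)
  then obtain n t \<Theta> where *: "t 0 = 0" "\<forall>j<n. t j < t (Suc j)" "t n = a" "\<forall>j\<in>{1..n}. \<Theta> j \<in> J"
    "v = (\<Sum>j=1..n. \<Theta> j * (x (t j) - x (t (j - 1)))) - (\<Sum>j=1..n. (t j - t (j - 1)) * k (\<Theta> j))"
    by blast
  let ?t = "t(Suc n := b)" and ?\<Theta> = "fun_upd \<Theta> (Suc n) \<theta>"
  have 1: "(\<Sum>j=1..n. ?\<Theta> j * (x (?t j) - x (?t (j - 1)))) = (\<Sum>j=1..n. \<Theta> j * (x (t j) - x (t (j - 1))))"
    by (rule sum.cong) auto
  have 2: "(\<Sum>j=1..n. (?t j - ?t (j - 1)) * k (?\<Theta> j)) = (\<Sum>j=1..n. (t j - t (j - 1)) * k (\<Theta> j))"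
    by (rule sum.cong) auto
  have "v + \<theta> * (x b - x a) - (b - a) * k \<theta> =
      (\<Sum>j=1..Suc n. ?\<Theta> j * (x (?t j) - x (?t (j - 1)))) - (\<Sum>j=1..Suc n. (?t j - ?t (j - 1)) * k (?\<Theta> j))"
    using *(3,5) 1 2 by (simp add: sum.cl_ivl_Suc)
  moreover have "\<forall>j<Suc n. ?t j < ?t (Suc j)"
    using *(2,3) advance.hyps by (auto simp: less_Suc_eq)
  moreover have "\<forall>j\<in>{1..Suc n}. ?\<Theta> j \<in> J"
    using *(4) advance.hyps by auto
  ultimately show ?case
    using *(1) by (intro exI[of _ "Suc n"] exI[of _ ?t] exI[of _ ?\<Theta>]) simp
qed

lemma subdivision_strategy_value:
  assumes "t 0 = 0" "\<forall>j<n. t j < t (Suc j)" "t n \<le> T" "\<forall>j\<in>{1..n}. \<Theta> j \<in> J"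
  shows "strategy_value J k T x (t n)
    ((\<Sum>j=1..n. \<Theta> j * (x (t j) - x (t (j - 1)))) - (\<Sum>j=1..n. (t j - t (j - 1)) * k (\<Theta> j)))"
  using assms
proof (induction n)
  case 0
  then show ?case using strategy_value.start[of J k T x] by simp
next
  case (Suc n)
  have "t n < t (Suc n)" using Suc.prems by simp
  with Suc have "strategy_value J k T x (t n)
    ((\<Sum>j=1..n. \<Theta> j * (x (t j) - x (t (j - 1)))) - (\<Sum>j=1..n. (t j - t (j - 1)) * k (\<Theta> j)))"
    by auto
  from advance[OF this \<open>t n < t (Suc n)\<close>, of "\<Theta> (Suc n)"] Suc.prems
  show ?case by (simp add: algebra_simps)
qed

text \<open>The real function \<open>k\<close> carries the values of the extended real \<open>h\<close> on \<open>J\<close>, so that arithmetic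
  can be done in the reals.\<close>

locale cost_function =
  fixes J :: "real set" and h :: "real \<Rightarrow> ereal" and k :: "real \<Rightarrow> real" and c :: real
  assumes cost: "\<theta> \<in> J \<Longrightarrow> h \<theta> = ereal (k \<theta>)"
    and zero_mem: "0 \<in> J" and cost_zero: "k 0 = 0"
    and cost_lower: "\<theta> \<in> J \<Longrightarrow> - c \<le> k \<theta>"
    and has_pos: "\<exists>p\<in>J. 0 < p" and has_neg: "\<exists>q\<in>J. q < 0"
begin

lemma path_rate_eq:
  assumes "0 < T"
  shows "path_rate J h T x = (SUP v\<in>{v. \<exists>a. strategy_value J k T x a v}. ereal v)"
proof (rule antisym)
  have gain: "(\<Sum>j=1..n. ereal (\<Theta> j * (x (t j) - x (t (j - 1))))) -
      (\<Sum>j=1..n. ereal (t j - t (j - 1)) * h (\<Theta> j)) =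
      ereal ((\<Sum>j=1..n. \<Theta> j * (x (t j) - x (t (j - 1)))) - (\<Sum>j=1..n. (t j - t (j - 1)) * k (\<Theta> j)))"
    if "\<forall>j\<in>{1..n}. \<Theta> j \<in> J" for n :: nat and t \<Theta> :: "nat \<Rightarrow> real"
  proof -
    have "(\<Sum>j=1..n. ereal (t j - t (j - 1)) * h (\<Theta> j)) = (\<Sum>j=1..n. ereal ((t j - t (j - 1)) * k (\<Theta> j)))"
      using that by (intro sum.cong) (auto simp: cost)
    then show ?thesis by (simp only: sum_ereal ereal_minus)
  qed
  show "path_rate J h T x \<le> (SUP v\<in>{v. \<exists>a. strategy_value J k T x a v}. ereal v)"
    unfolding path_rate_def
  proof (rule Sup_least, clarify)
    fix n :: nat and t \<Theta> :: "nat \<Rightarrow> real"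
    assume *: "1 \<le> n" "t 0 = 0" "\<forall>j<n. t j < t (Suc j)" "t n \<le> T" "\<forall>j\<in>{1..n}. \<Theta> j \<in> J"
    show "(\<Sum>j=1..n. ereal (\<Theta> j * (x (t j) - x (t (j - 1))))) -
      (\<Sum>j=1..n. ereal (t j - t (j - 1)) * h (\<Theta> j)) \<le> (SUP v\<in>{v. \<exists>a. strategy_value J k T x a v}. ereal v)"
      unfolding gain[OF *(5)]
      using subdivision_strategy_value[OF *(2-5), of k x] by (intro SUP_upper) blast
  qed
  have upper: "ereal ((\<Sum>j=1..n. \<Theta> j * (x (t j) - x (t (j - 1)))) - (\<Sum>j=1..n. (t j - t (j - 1)) * k (\<Theta> j)))
      \<le> path_rate J h T x"
    if "1 \<le> n" "t 0 = 0" "\<forall>j<n. t j < t (Suc j)" "t n \<le> T" "\<forall>j\<in>{1..n}. \<Theta> j \<in> J"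
    for n :: nat and t \<Theta> :: "nat \<Rightarrow> real"
    unfolding path_rate_def gain[OF that(5), symmetric]
    using that by (intro Sup_upper) blast
  show "(SUP v\<in>{v. \<exists>a. strategy_value J k T x a v}. ereal v) \<le> path_rate J h T x"
  proof (rule SUP_least, clarify)
    fix v a assume sv: "strategy_value J k T x a v"
    from strategy_value_subdivision[OF sv] obtain n t \<Theta> where
      *: "t 0 = 0" "\<forall>j<n. t j < t (Suc j)" "t n = a" "\<forall>j\<in>{1..n}. \<Theta> j \<in> J"
      "v = (\<Sum>j=1..n. \<Theta> j * (x (t j) - x (t (j - 1)))) - (\<Sum>j=1..n. (t j - t (j - 1)) * k (\<Theta> j))"
      "n = 0 \<longrightarrow> v = 0" by blast
    \<comment> \<open>Subdivisions have at least one period; the strategy that has not begun to trade is matched by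
      holding \<open>0\<close> until \<open>T\<close>.\<close>
    show "ereal v \<le> path_rate J h T x"
    proof (cases "n = 0")
      case True
      with upper[of 1 "\<lambda>j. if j = 0 then 0 else T" "\<lambda>_. 0"] assms *(6) show ?thesis
        by (simp add: zero_mem cost_zero)
    next
      case False
      then show ?thesis
        unfolding *(5) using * strategy_value_time[OF sv assms] by (intro upper) auto
    qed
  qed
qed

lemma strategy_le_path_rate:
  assumes "0 < T" "strategy_value J k T x a v"
  shows "ereal v \<le> path_rate J h T x"
  unfolding path_rate_eq[OF assms(1)] using assms(2) by (intro SUP_upper) blast

lemma path_rate_nonneg: "0 < T \<Longrightarrow> 0 \<le> path_rate J h T x"
  using strategy_le_path_rate[OF _ strategy_value.start] by (simp add: zero_ereal_def)

text \<open>With \<open>p > 0\<close> and \<open>q < 0\<close> in \<open>J\<close>, holding \<open>p\<close> over rises and \<open>q\<close> over falls earns at least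
  \<open>min p (- q)\<close> times the variation, at a cost of at most a constant times \<open>T\<close>.\<close>

lemma path_rate_unbounded_variation:
  assumes T: "0 < T" and unbounded: "\<not> has_bounded_variation T x"
  shows "path_rate J h T x = \<infinity>"
proof (rule ccontr)
  assume "path_rate J h T x \<noteq> \<infinity>"
  with path_rate_nonneg[OF T, of x] obtain B where B: "path_rate J h T x = ereal B"
    by (cases "path_rate J h T x") auto
  obtain p q where pq: "p \<in> J" "0 < p" "q \<in> J" "q < 0" using has_pos has_neg by blast
  define m where "m = min p (- q)"
  define K where "K = max 0 (max (k p) (k q))"
  have m: "0 < m" using pq by (simp add: m_def)
  have step: "\<exists>\<theta>\<in>J. m * \<bar>d\<bar> \<le> \<theta> * d \<and> k \<theta> \<le> K" for d
  proof (cases "0 \<le> d")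
    case True
    then have "m * \<bar>d\<bar> \<le> p * d" by (auto simp: m_def intro!: mult_right_mono)
    then show ?thesis using pq by (intro bexI[of _ p]) (auto simp: K_def)
  next
    case False
    then have "m * (- d) \<le> (- q) * (- d)" by (intro mult_right_mono) (auto simp: m_def)
    then show ?thesis using pq False by (intro bexI[of _ q]) (auto simp: K_def)
  qed
  have reach: "\<exists>v. strategy_value J k T x (t n) v \<and> m * (\<Sum>j<n. \<bar>x (t (Suc j)) - x (t j)\<bar>) - K * t n \<le> v"
    if "0 \<le> t 0" "\<forall>j<n. t j \<le> t (Suc j)" "t n \<le> T" for n :: nat and t :: "nat \<Rightarrow> real"
    using that
  proof (induction n)
    case 0
    have "0 \<le> K * t 0" using 0 by (simp add: K_def)
    moreover have "strategy_value J k T x (t 0) 0"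
      using advance_weakly[OF strategy_value.start, where b = "t 0" and \<theta> = 0 and J = J and k = k and T = T and x = x]
      0 by (simp add: zero_mem cost_zero)
    ultimately show ?case by auto
  next
    case (Suc n)
    have le: "t n \<le> t (Suc n)" using Suc.prems by simp
    with Suc obtain v where v: "strategy_value J k T x (t n) v"
      "m * (\<Sum>j<n. \<bar>x (t (Suc j)) - x (t j)\<bar>) - K * t n \<le> v" by fastforce
    obtain \<theta> where \<theta>: "\<theta> \<in> J" "m * \<bar>x (t (Suc n)) - x (t n)\<bar> \<le> \<theta> * (x (t (Suc n)) - x (t n))" "k \<theta> \<le> K"
      using step by blast
    have "(t (Suc n) - t n) * k \<theta> \<le> (t (Suc n) - t n) * K"
      using le \<theta>(3) by (intro mult_left_mono) auto
    then show ?case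
      using v \<theta> le Suc.prems
      by (intro exI[of _ "v + \<theta> * (x (t (Suc n)) - x (t n)) - (t (Suc n) - t n) * k \<theta>"] conjI advance_weakly)
        (auto simp: algebra_simps)
  qed
  have "has_bounded_variation T x"
    unfolding has_bounded_variation_def
  proof (rule exI[of _ "(B + K * T) / m"], intro allI impI)
    fix n and t :: "nat \<Rightarrow> real" assume *: "0 \<le> t 0 \<and> (\<forall>j<n. t j \<le> t (Suc j)) \<and> t n \<le> T"
    with reach[of t n] obtain v where v: "strategy_value J k T x (t n) v"
      "m * (\<Sum>j<n. \<bar>x (t (Suc j)) - x (t j)\<bar>) - K * t n \<le> v" by blast
    have "v \<le> B" using strategy_le_path_rate[OF T v(1)] by (simp add: B)
    moreover have "K * t n \<le> K * T" using * by (intro mult_left_mono) (auto simp: K_def)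
    ultimately have "m * (\<Sum>j<n. \<bar>x (t (Suc j)) - x (t j)\<bar>) \<le> B + K * T" using v(2) by linarith
    then show "(\<Sum>j<n. \<bar>x (t (Suc j)) - x (t j)\<bar>) \<le> (B + K * T) / m"
      using m by (simp add: pos_le_divide_eq mult.commute)
  qed
  with unbounded show False by simp
qed

section \<open>The recession function as a support function\<close>

definition support :: "real \<Rightarrow> ereal" where
  "support y = (SUP \<theta>\<in>J. ereal (\<theta> * y))"

lemma conjugate_eq: "conjugate J h y = (SUP \<theta>\<in>J. ereal (\<theta> * y - k \<theta>))"
  unfolding conjugate_def by (rule SUP_cong) (auto simp: cost)

lemma conjugate_nonneg: "0 \<le> conjugate J h y"
  unfolding conjugate_eq by (rule SUP_upper2[OF zero_mem]) (simp add: cost_zero)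

lemma support_nonneg: "0 \<le> support y"
  unfolding support_def by (rule SUP_upper2[OF zero_mem]) simp

text \<open>Scaling turns \<open>\<epsilon> h\<^sup>*(y / \<epsilon>)\<close> into the supremum of \<open>\<theta> y - \<epsilon> k \<theta>\<close>. Each term tends to
  \<open>\<theta> y\<close>, which bounds the limit from below; the lower bound on \<open>k\<close> makes the excess over the support
  function at most \<open>\<epsilon> c\<close>, uniformly in \<open>\<theta>\<close>.\<close>

lemma recession_eq_support: "recession J h y = support y"
proof -
  have eq: "ereal \<epsilon> * conjugate J h (y / \<epsilon>) = (SUP \<theta>\<in>J. ereal (\<theta> * y - \<epsilon> * k \<theta>))" if "0 < \<epsilon>" for \<epsilon>
  proof -
    have "ereal \<epsilon> * conjugate J h (y / \<epsilon>) = (SUP \<theta>\<in>J. ereal \<epsilon> * ereal (\<theta> * (y / \<epsilon>) - k \<theta>))"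
      unfolding conjugate_eq using that zero_mem by (intro Sup_ereal_mult_left') auto
    also have "\<dots> = (SUP \<theta>\<in>J. ereal (\<theta> * y - \<epsilon> * k \<theta>))"
      using that by (intro SUP_cong) (auto simp: field_simps)
    finally show ?thesis .
  qed
  have "((\<lambda>\<epsilon>. ereal \<epsilon> * conjugate J h (y / \<epsilon>)) \<longlongrightarrow> support y) (at_right 0)"
  proof (rule order_tendstoI)
    fix a assume "a < support y"
    then obtain \<theta> where \<theta>: "\<theta> \<in> J" "a < ereal (\<theta> * y)" unfolding support_def less_SUP_iff by blast
    have "((\<lambda>\<epsilon>. ereal (\<theta> * y - \<epsilon> * k \<theta>)) \<longlongrightarrow> ereal (\<theta> * y - 0 * k \<theta>)) (at_right 0)"
      by (intro tendsto_intros)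
    then have "\<forall>\<^sub>F \<epsilon> in at_right 0. a < ereal (\<theta> * y - \<epsilon> * k \<theta>)"
      using \<theta>(2) by (intro order_tendstoD(1)) auto
    then show "\<forall>\<^sub>F \<epsilon> in at_right 0. a < ereal \<epsilon> * conjugate J h (y / \<epsilon>)"
      using eventually_at_right_less
    proof eventually_elim
      case (elim \<epsilon>)
      then show ?case unfolding eq[OF elim(2)] less_SUP_iff using \<theta>(1) by blast
    qed
  next
    fix a assume a: "support y < a"
    then obtain s where s: "support y = ereal s" using support_nonneg[of y] by (cases "support y") auto
    have "((\<lambda>\<epsilon>. ereal (s + \<epsilon> * c)) \<longlongrightarrow> ereal (s + 0 * c)) (at_right 0)"
      by (intro tendsto_intros)
    then have "\<forall>\<^sub>F \<epsilon> in at_right 0. ereal (s + \<epsilon> * c) < a"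
      using a s by (intro order_tendstoD(2)) auto
    then show "\<forall>\<^sub>F \<epsilon> in at_right 0. ereal \<epsilon> * conjugate J h (y / \<epsilon>) < a"
      using eventually_at_right_less
    proof eventually_elim
      case (elim \<epsilon>)
      have "(SUP \<theta>\<in>J. ereal (\<theta> * y - \<epsilon> * k \<theta>)) \<le> ereal (s + \<epsilon> * c)"
      proof (rule SUP_least)
        fix \<theta> assume "\<theta> \<in> J"
        then have "ereal (\<theta> * y) \<le> ereal s" unfolding s[symmetric] support_def by (rule SUP_upper)
        moreover have "\<epsilon> * (- c) \<le> \<epsilon> * k \<theta>"
          using cost_lower[OF \<open>\<theta> \<in> J\<close>] elim(2) by (intro mult_left_mono) auto
        ultimately show "ereal (\<theta> * y - \<epsilon> * k \<theta>) \<le> ereal (s + \<epsilon> * c)" by simp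
      qed
      then show ?case unfolding eq[OF elim(2)] using elim(1) by (rule le_less_trans)
    qed
  qed
  then show ?thesis unfolding recession_def by (intro tendsto_Lim) auto
qed

text \<open>A countable dense subset of the graph of \<open>k\<close> serves both suprema at once, because \<open>\<theta> y - b k(\<theta>)\<close>
  depends continuously on the point \<open>(\<theta>, k \<theta>)\<close> of the graph; \<open>k\<close> itself may be discontinuous. The
  sequence starts at \<open>0\<close> so that the partial maxima are nonnegative.\<close>

lemma dense_sequence:
  obtains e :: "nat \<Rightarrow> real" where "e 0 = 0" "range e \<subseteq> J"
    "\<And>y. conjugate J h y = (SUP n. ereal (e n * y - k (e n)))"
    "\<And>y. support y = (SUP n. ereal (e n * y))"
proof -
  define G where "G = (\<lambda>\<theta>. (\<theta>, k \<theta>)) ` J"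
  obtain G0 where G0: "countable G0" "G0 \<subseteq> G" "G \<subseteq> closure G0" using separable by blast
  define J0 where "J0 = insert 0 (fst ` G0)"
  define e where "e = (\<lambda>n. case n of 0 \<Rightarrow> 0 | Suc n \<Rightarrow> from_nat_into J0 n)"
  have J0: "countable J0" "J0 \<noteq> {}" "J0 \<subseteq> J" using G0(1,2) zero_mem by (auto simp: J0_def G_def)
  have "range e \<subseteq> J0" using from_nat_into[OF J0(2)] by (auto simp: e_def split: nat.splits) (simp add: J0_def)
  moreover have "J0 \<subseteq> range e"
  proof
    fix \<theta> assume "\<theta> \<in> J0"
    then obtain n where "from_nat_into J0 n = \<theta>" using from_nat_into_surj[OF J0(1)] by blast
    then have "\<theta> = e (Suc n)" by (simp add: e_def)
    then show "\<theta> \<in> range e" by blast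
  qed
  ultimately have range_e: "range e = J0" by (rule antisym)
  have dense: "(SUP \<theta>\<in>J. ereal (\<theta> * y - b * k \<theta>)) = (SUP n. ereal (e n * y - b * k (e n)))" for y b
  proof (rule antisym)
    show "(SUP \<theta>\<in>J. ereal (\<theta> * y - b * k \<theta>)) \<le> (SUP n. ereal (e n * y - b * k (e n)))"
    proof (rule SUP_least, rule dense_le)
      fix \<theta> z assume \<theta>: "\<theta> \<in> J" and z: "z < ereal (\<theta> * y - b * k \<theta>)"
      define U where "U = {p. z < ereal (fst p * y - b * snd p)}"
      have "open U" unfolding U_def by (intro open_Collect_less continuous_intros)
      moreover have "(\<theta>, k \<theta>) \<in> U \<inter> closure G0" using G0(3) \<theta> z by (auto simp: U_def G_def)
      ultimately have "U \<inter> G0 \<noteq> {}" using open_Int_closure_eq_empty by blast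
      then obtain p where p: "p \<in> U" "p \<in> G0" by blast
      with G0(2) obtain \<eta> where "p = (\<eta>, k \<eta>)" unfolding G_def by blast
      with p have "(\<eta>, k \<eta>) \<in> G0" "z < ereal (\<eta> * y - b * k \<eta>)" by (auto simp: U_def)
      moreover from this have "\<eta> \<in> range e" unfolding range_e J0_def by force
      ultimately obtain n where "z < ereal (e n * y - b * k (e n))" by blast
      then show "z \<le> (SUP n. ereal (e n * y - b * k (e n)))" by (intro SUP_upper2[of n]) auto
    qed
    show "(SUP n. ereal (e n * y - b * k (e n))) \<le> (SUP \<theta>\<in>J. ereal (\<theta> * y - b * k \<theta>))"
      using range_e J0(3) by (intro SUP_mono) auto
  qed
  show ?thesis
  proof (rule that)
    show "e 0 = 0" by (simp add: e_def)
    show "range e \<subseteq> J" using range_e J0(3) by simp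
    show "conjugate J h y = (SUP n. ereal (e n * y - k (e n)))" for y
      using dense[of y 1] by (simp add: conjugate_eq)
    show "support y = (SUP n. ereal (e n * y))" for y
      using dense[of y 0] by (simp add: support_def)
  qed
qed

end

section \<open>Approximation of measurable functions by step functions\<close>

text \<open>The cells are \<open>[0, d\<^sub>1]\<close>, \<open>(d\<^sub>1, d\<^sub>2]\<close>, \<dots>, \<open>(d\<^sub>n, T]\<close> for the points \<open>d\<^sub>i\<close> of \<open>D\<close>. Stated without
  an enumeration of \<open>D\<close>, the condition survives enlarging \<open>D\<close>, so two step functions share a common
  refinement for free.\<close>

definition piecewise_constant :: "real \<Rightarrow> real set \<Rightarrow> (real \<Rightarrow> 'b) \<Rightarrow> bool" where
  "piecewise_constant T D s \<longleftrightarrow> (\<forall>a b. 0 \<le> a \<and> a \<le> b \<and> b \<le> T \<and> D \<inter> {a..<b} = {} \<longrightarrow> s a = s b)"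

text \<open>Switching times must not be atoms of \<open>\<rho>\<close>: at an atom of \<open>dx\<close> the value of the path may lie
  anywhere between its one-sided limits, so increments up to that time are not determined by \<open>dx\<close>.\<close>

definition approximable :: "real measure \<Rightarrow> real \<Rightarrow> 'b set \<Rightarrow> (real \<Rightarrow> 'b) \<Rightarrow> bool" where
  "approximable \<rho> T K f \<longleftrightarrow> (\<forall>\<epsilon>>0. \<exists>D s E. finite D \<and> D \<subseteq> {0<..<T} \<and> (\<forall>d\<in>D. measure \<rho> {d} = 0) \<and>
     piecewise_constant T D s \<and> s ` {0..T} \<subseteq> K \<and>
     E \<in> sets \<rho> \<and> (\<forall>t\<in>{0..T} - E. s t = f t) \<and> measure \<rho> E < \<epsilon>)"

lemma approximable_const: "u \<in> K \<Longrightarrow> approximable \<rho> T K (\<lambda>_. u)"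
  unfolding approximable_def piecewise_constant_def
  by (intro allI impI exI[of _ "{}"] exI[of _ "\<lambda>_. u"]) auto

lemma approximable_combine:
  assumes fin: "finite_measure \<rho>" and f: "approximable \<rho> T K f" and f': "approximable \<rho> T K' f'"
    and F: "\<And>a b. a \<in> K \<Longrightarrow> b \<in> K' \<Longrightarrow> F a b \<in> K''"
  shows "approximable \<rho> T K'' (\<lambda>t. F (f t) (f' t))"
  unfolding approximable_def
proof (intro allI impI)
  interpret finite_measure \<rho> by (rule fin)
  fix \<epsilon> :: real assume "0 < \<epsilon>"
  then have e: "0 < \<epsilon> / 2" by simp
  obtain D s E where 1: "finite D" "D \<subseteq> {0<..<T}" "\<forall>d\<in>D. measure \<rho> {d} = 0"
    "piecewise_constant T D s" "s ` {0..T} \<subseteq> K" "E \<in> sets \<rho>" "\<forall>t\<in>{0..T} - E. s t = f t" "measure \<rho> E < \<epsilon> / 2"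
    using f e unfolding approximable_def by metis
  obtain D' s' E' where 2: "finite D'" "D' \<subseteq> {0<..<T}" "\<forall>d\<in>D'. measure \<rho> {d} = 0"
    "piecewise_constant T D' s'" "s' ` {0..T} \<subseteq> K'" "E' \<in> sets \<rho>" "\<forall>t\<in>{0..T} - E'. s' t = f' t" "measure \<rho> E' < \<epsilon> / 2"
    using f' e unfolding approximable_def by metis
  have "measure \<rho> (E \<union> E') < \<epsilon>"
    using measure_Un_le[OF 1(6) 2(6)] 1(8) 2(8) by linarith
  moreover have "piecewise_constant T (D \<union> D') (\<lambda>t. F (s t) (s' t))"
    unfolding piecewise_constant_def
  proof (intro allI impI)
    fix a b assume *: "0 \<le> a \<and> a \<le> b \<and> b \<le> T \<and> (D \<union> D') \<inter> {a..<b} = {}"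
    then have "D \<inter> {a..<b} = {}" "D' \<inter> {a..<b} = {}" by auto
    with * 1(4) 2(4) have "s a = s b" "s' a = s' b" unfolding piecewise_constant_def by blast+
    then show "F (s a) (s' a) = F (s b) (s' b)" by simp
  qed
  moreover have "(\<lambda>t. F (s t) (s' t)) ` {0..T} \<subseteq> K''" using 1(5) 2(5) F by blast
  moreover have "\<forall>t\<in>{0..T} - (E \<union> E'). F (s t) (s' t) = F (f t) (f' t)" using 1(7) 2(7) by simp
  ultimately show "\<exists>D s E. finite D \<and> D \<subseteq> {0<..<T} \<and> (\<forall>d\<in>D. measure \<rho> {d} = 0) \<and>
     piecewise_constant T D s \<and> s ` {0..T} \<subseteq> K'' \<and>
     E \<in> sets \<rho> \<and> (\<forall>t\<in>{0..T} - E. s t = F (f t) (f' t)) \<and> measure \<rho> E < \<epsilon>"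
    using 1(1-3,6) 2(1-3,6)
    by (intro exI[of _ "D \<union> D'"] exI[of _ "\<lambda>t. F (s t) (s' t)"] exI[of _ "E \<union> E'"]) auto
qed

lemma approximable_limit:
  assumes fin: "finite_measure \<rho>"
    and lim: "\<And>\<epsilon>. 0 < \<epsilon> \<Longrightarrow> \<exists>f' E'. approximable \<rho> T K f' \<and> E' \<in> sets \<rho> \<and>
      (\<forall>t\<in>{0..T} - E'. f' t = f t) \<and> measure \<rho> E' < \<epsilon>"
  shows "approximable \<rho> T K f"
  unfolding approximable_def
proof (intro allI impI)
  interpret finite_measure \<rho> by (rule fin)
  fix \<epsilon> :: real assume "0 < \<epsilon>"
  then have e: "0 < \<epsilon> / 2" by simp
  obtain f' E' where 2: "approximable \<rho> T K f'" "E' \<in> sets \<rho>"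
      "\<forall>t\<in>{0..T} - E'. f' t = f t" "measure \<rho> E' < \<epsilon> / 2"
    using lim[OF e] by blast
  obtain D s E where 1: "finite D" "D \<subseteq> {0<..<T}" "\<forall>d\<in>D. measure \<rho> {d} = 0"
    "piecewise_constant T D s" "s ` {0..T} \<subseteq> K" "E \<in> sets \<rho>" "\<forall>t\<in>{0..T} - E. s t = f' t" "measure \<rho> E < \<epsilon> / 2"
    using 2(1) e unfolding approximable_def by metis
  have "measure \<rho> (E \<union> E') < \<epsilon>"
    using measure_Un_le[OF 1(6) 2(2)] 1(8) 2(4) by linarith
  moreover have "\<forall>t\<in>{0..T} - (E \<union> E'). s t = f t" using 1(7) 2(3) by simp
  ultimately show "\<exists>D s E. finite D \<and> D \<subseteq> {0<..<T} \<and> (\<forall>d\<in>D. measure \<rho> {d} = 0) \<and>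
     piecewise_constant T D s \<and> s ` {0..T} \<subseteq> K \<and>
     E \<in> sets \<rho> \<and> (\<forall>t\<in>{0..T} - E. s t = f t) \<and> measure \<rho> E < \<epsilon>"
    using 1 2(2) by (intro exI[of _ D] exI[of _ s] exI[of _ "E \<union> E'"]) auto
qed

text \<open>Induction over the sigma-algebra generated by the half-lines \<open>{..a}\<close>. Only countably many points
  are atoms, so a half-line can be replaced by a slightly longer one that ends at a time which is not
  an atom.\<close>

lemma approximable_borel:
  assumes fin: "finite_measure \<rho>" and sets: "sets \<rho> = sets (lebesgue_upto T)" and A: "A \<in> sets borel"
  shows "approximable \<rho> T UNIV (\<lambda>t. t \<in> A)"
proof -
  interpret finite_measure \<rho> by (rule fin)
  have setI: "B \<inter> {0..T} \<in> sets \<rho>" if "B \<in> sets borel" for B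
    using that unfolding sets by (auto simp: sets_restrict_space)
  have "A \<in> sigma_sets UNIV (range (\<lambda>a. {..a}))"
    using A by (simp add: borel_eq_atMost)
  then show ?thesis
  proof induction
    case (Basic A)
    then obtain a where A: "A = {..a}" by auto
    consider "a < 0" | "T \<le> a" | "0 \<le> a" "a < T" by linarith
    then show ?case
    proof cases
      case 1
      then show ?thesis
        by (intro approximable_limit[OF fin] exI[of _ "\<lambda>_. False"] exI[of _ "{}"]) (auto simp: A approximable_const)
    next
      case 2
      then show ?thesis
        by (intro approximable_limit[OF fin] exI[of _ "\<lambda>_. True"] exI[of _ "{}"]) (auto simp: A approximable_const)
    next
      case 3
      show ?thesis
        unfolding approximable_def
      proof (intro allI impI)
        fix \<epsilon> :: real assume \<epsilon>: "0 < \<epsilon>"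
        define B where "B = (\<lambda>n. {a<..a + 1 / real (Suc n)} \<inter> {0..T})"
        have "decseq B"
          unfolding B_def
        proof (intro decseq_SucI Int_mono order_refl)
          fix n
          have "1 / real (Suc (Suc n)) \<le> 1 / real (Suc n)" by (intro divide_left_mono) auto
          then show "{a<..a + 1 / real (Suc (Suc n))} \<subseteq> {a<..a + 1 / real (Suc n)}" by auto
        qed
        then have lim: "(\<lambda>n. measure \<rho> (B n)) \<longlonglongrightarrow> measure \<rho> (\<Inter>n. B n)"
          by (intro finite_Lim_measure_decseq) (auto simp: B_def intro!: setI)
        have "(\<Inter>n. B n) = {}"
        proof (rule ccontr)
          assume "(\<Inter>n. B n) \<noteq> {}"
          then obtain t where t: "\<And>n. t \<in> B n" by blast
          then have "a < t" by (auto simp: B_def)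
          then obtain n where "1 / real (Suc n) < t - a" using reals_Archimedean[of "t - a"] by (auto simp: inverse_eq_divide)
          with t[of n] show False by (auto simp: B_def)
        qed
        with lim have "(\<lambda>n. measure \<rho> (B n)) \<longlonglongrightarrow> 0" by simp
        then have "\<forall>\<^sub>F n in sequentially. measure \<rho> (B n) < \<epsilon>" using \<epsilon> by (rule order_tendstoD)
        then obtain n where n: "measure \<rho> (B n) < \<epsilon>" by (auto simp: eventually_sequentially)
        have "uncountable ({a<..<min T (a + 1 / real (Suc n))} - {b. measure \<rho> {b} \<noteq> 0})"
          using 3 countable_support by (intro uncountable_minus_countable) (auto simp: uncountable_open_interval)
        then have "{a<..<min T (a + 1 / real (Suc n))} - {b. measure \<rho> {b} \<noteq> 0} \<noteq> {}"
          by (metis countable_empty)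
        then obtain b where b: "a < b" "b < T" "b < a + 1 / real (Suc n)" "measure \<rho> {b} = 0"
          by auto
        have "measure \<rho> ({a<..b} \<inter> {0..T}) \<le> measure \<rho> (B n)"
          using b by (intro finite_measure_mono) (auto simp: B_def intro!: setI)
        with n have "measure \<rho> ({a<..b} \<inter> {0..T}) < \<epsilon>" by simp
        moreover have "piecewise_constant T {b} (\<lambda>t. t \<le> b)"
          by (auto simp: piecewise_constant_def)
        ultimately show "\<exists>D s E. finite D \<and> D \<subseteq> {0<..<T} \<and> (\<forall>d\<in>D. measure \<rho> {d} = 0) \<and>
           piecewise_constant T D s \<and> s ` {0..T} \<subseteq> UNIV \<and>
           E \<in> sets \<rho> \<and> (\<forall>t\<in>{0..T} - E. s t = (t \<in> A)) \<and> measure \<rho> E < \<epsilon>"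
          using b 3
          by (intro exI[of _ "{b}"] exI[of _ "\<lambda>t. t \<le> b"] exI[of _ "{a<..b} \<inter> {0..T}"]) (auto simp: A intro!: setI)
      qed
    qed
  next
    case Empty
    show ?case by (simp add: approximable_const)
  next
    case (Compl A)
    from approximable_combine[OF fin Compl.IH Compl.IH, of "\<lambda>a b. \<not> a" UNIV] show ?case by simp
  next
    case (Union A)
    \<comment> \<open>Finite unions are handled by merging step functions; the tail of a countable union has small measure.\<close>
    have fin_union: "approximable \<rho> T UNIV (\<lambda>t. t \<in> (\<Union>i<n. A i))" for n
    proof (induction n)
      case 0
      then show ?case by (simp add: approximable_const)
    next
      case (Suc n)
      from approximable_combine[OF fin Suc Union.IH[of n], of "\<lambda>a b. a \<or> b" UNIV] show ?case
        by (simp add: lessThan_Suc disj_commute)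
    qed
    have borel: "A i \<in> sets borel" for i
      using Union.hyps by (simp add: borel_eq_atMost)
    show ?case
    proof (rule approximable_limit[OF fin])
      fix \<epsilon> :: real assume \<epsilon>: "0 < \<epsilon>"
      define B where "B = (\<lambda>n. ((\<Union>i. A i) - (\<Union>i<n. A i)) \<inter> {0..T})"
      have B: "B n \<in> sets \<rho>" for n unfolding B_def using borel by (intro setI) auto
      have "decseq B" unfolding B_def decseq_Suc_iff by (auto simp: less_Suc_eq)
      then have lim: "(\<lambda>n. measure \<rho> (B n)) \<longlonglongrightarrow> measure \<rho> (\<Inter>n. B n)"
        using B by (intro finite_Lim_measure_decseq) auto
      have "(\<Inter>n. B n) = {}"
      proof (rule ccontr)
        assume "(\<Inter>n. B n) \<noteq> {}"
        then obtain t where t: "\<And>n. t \<in> B n" by blast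
        then obtain i where "t \<in> A i" by (auto simp: B_def)
        with t[of "Suc i"] show False by (auto simp: B_def)
      qed
      with lim have "(\<lambda>n. measure \<rho> (B n)) \<longlonglongrightarrow> 0" by simp
      then have "\<forall>\<^sub>F n in sequentially. measure \<rho> (B n) < \<epsilon>" using \<epsilon> by (rule order_tendstoD)
      then obtain n where "measure \<rho> (B n) < \<epsilon>" by (auto simp: eventually_sequentially)
      then show "\<exists>f' E'. approximable \<rho> T UNIV f' \<and> E' \<in> sets \<rho> \<and>
          (\<forall>t\<in>{0..T} - E'. f' t = (t \<in> (\<Union>i. A i))) \<and> measure \<rho> E' < \<epsilon>"
        using B fin_union[of n]
        by (intro exI[of _ "\<lambda>t. t \<in> (\<Union>i<n. A i)"] exI[of _ "B n"]) (auto simp: B_def)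
    qed
  qed
qed

section \<open>Integrals over cells\<close>

lemma integral_le_measure_density:
  fixes \<phi> :: "'a \<Rightarrow> real"
  assumes \<phi>: "integrable M \<phi>" and F: "F \<in> borel_measurable M" and le: "\<And>t. ennreal (\<phi> t) \<le> F t"
    and fin: "(\<integral>\<^sup>+ t. F t \<partial>M) < \<infinity>" and A: "A \<in> sets M"
  shows "(LINT t:A|M. \<phi> t) \<le> measure (density M F) A"
proof -
  have int: "integrable M (\<lambda>t. indicator A t * \<phi> t)"
    using integrable_mult_indicator[OF A \<phi>] by simp
  have "(LINT t:A|M. \<phi> t) = (LINT t|M. indicator A t * \<phi> t)"
    by (simp add: set_lebesgue_integral_def)
  also have "\<dots> \<le> enn2real (\<integral>\<^sup>+ t. ennreal (indicator A t * \<phi> t) \<partial>M)"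
    unfolding real_lebesgue_integral_def[OF int] by simp
  also have "\<dots> \<le> enn2real (\<integral>\<^sup>+ t. F t * indicator A t \<partial>M)"
  proof (rule enn2real_mono)
    show "(\<integral>\<^sup>+ t. ennreal (indicator A t * \<phi> t) \<partial>M) \<le> (\<integral>\<^sup>+ t. F t * indicator A t \<partial>M)"
      using le by (intro nn_integral_mono) (auto split: split_indicator)
    have "(\<integral>\<^sup>+ t. F t * indicator A t \<partial>M) \<le> (\<integral>\<^sup>+ t. F t \<partial>M)"
      by (intro nn_integral_mono) (auto split: split_indicator)
    with fin show "(\<integral>\<^sup>+ t. F t * indicator A t \<partial>M) < top" by (metis infinity_ennreal_def order_le_less_trans)
  qed
  also have "\<dots> = measure (density M F) A"
    by (simp add: measure_def emeasure_density[OF F A])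
  finally show ?thesis .
qed

text \<open>Replacing a position by the constant \<open>u\<close> on a cell changes its profit only where the two differ,
  and there by at most \<open>2 C\<close> times the density \<open>b\<close>. The number \<open>r\<close> is the weight of the running cost
  in \<open>b\<close>: \<open>1\<close> for integrals over time and \<open>0\<close> for integrals against the singular part.\<close>

lemma cell_gain:
  fixes f \<psi> :: "'a \<Rightarrow> real"
  assumes f: "integrable M (\<lambda>t. f t * \<psi> t - \<kappa> (f t))" and \<psi>: "integrable M \<psi>"
    and b: "integrable M b" "\<And>t. \<bar>\<psi> t\<bar> + r \<le> b t"
    and A: "A \<in> sets M" and E: "E \<in> sets M" and fin: "finite_measure M"
    and eq: "\<And>t. t \<in> A - E \<Longrightarrow> f t = u"
    and C: "\<bar>u\<bar> \<le> C" "\<bar>\<kappa> u\<bar> \<le> C * r" "\<And>t. t \<in> A \<Longrightarrow> \<bar>f t\<bar> \<le> C \<and> \<bar>\<kappa> (f t)\<bar> \<le> C * r"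
  shows "(LINT t:A|M. f t * \<psi> t - \<kappa> (f t)) \<le> u * (LINT t:A|M. \<psi> t) - \<kappa> u * measure M A + 2 * C * (LINT t:A \<inter> E|M. b t)"
proof -
  interpret finite_measure M by (rule fin)
  have int1: "integrable M (\<lambda>t. indicator A t * (u * \<psi> t - \<kappa> u))"
    using integrable_mult_indicator[OF A, of "\<lambda>t. u * \<psi> t - \<kappa> u"] \<psi> by simp
  have int2: "integrable M (\<lambda>t. indicator (A \<inter> E) t * (2 * C * b t))"
    using integrable_mult_indicator[OF sets.Int[OF A E], of "\<lambda>t. 2 * C * b t"] b(1) by simp
  have "(LINT t:A|M. f t * \<psi> t - \<kappa> (f t)) = (LINT t|M. indicator A t * (f t * \<psi> t - \<kappa> (f t)))"
    by (simp add: set_lebesgue_integral_def)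
  also have "\<dots> \<le> (LINT t|M. indicator A t * (u * \<psi> t - \<kappa> u) + indicator (A \<inter> E) t * (2 * C * b t))"
  proof (rule integral_mono)
    show "integrable M (\<lambda>t. indicator A t * (f t * \<psi> t - \<kappa> (f t)))"
      using integrable_mult_indicator[OF A f] by simp
    show "integrable M (\<lambda>t. indicator A t * (u * \<psi> t - \<kappa> u) + indicator (A \<inter> E) t * (2 * C * b t))"
      by (intro Bochner_Integration.integrable_add int1 int2)
    fix t
    have "f t * \<psi> t - \<kappa> (f t) \<le> u * \<psi> t - \<kappa> u + 2 * C * b t" if "t \<in> A"
    proof -
      have "\<bar>f t - u\<bar> \<le> 2 * C" using C(1) C(3)[OF that] by linarith
      then have "(f t - u) * \<psi> t \<le> 2 * C * \<bar>\<psi> t\<bar>"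
        using mult_right_mono[of "\<bar>f t - u\<bar>" "2 * C" "\<bar>\<psi> t\<bar>"] abs_ge_self[of "(f t - u) * \<psi> t"]
        by (simp add: abs_mult)
      moreover have "\<kappa> u - \<kappa> (f t) \<le> 2 * C * r"
        using C(2) C(3)[OF that] by (simp add: abs_le_iff)
      ultimately have "(f t - u) * \<psi> t + (\<kappa> u - \<kappa> (f t)) \<le> 2 * C * (\<bar>\<psi> t\<bar> + r)"
        by (simp only: distrib_left)
      also have "\<dots> \<le> 2 * C * b t" using b(2)[of t] C(1) by (intro mult_left_mono) auto
      finally show ?thesis by (simp add: algebra_simps)
    qed
    then show "indicator A t * (f t * \<psi> t - \<kappa> (f t)) \<le> indicator A t * (u * \<psi> t - \<kappa> u) + indicator (A \<inter> E) t * (2 * C * b t)"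
      using eq[of t] by (auto split: split_indicator)
  qed
  also have "\<dots> = (LINT t|M. indicator A t * (u * \<psi> t - \<kappa> u)) + (LINT t|M. indicator (A \<inter> E) t * (2 * C * b t))"
    by (rule Bochner_Integration.integral_add[OF int1 int2])
  also have "(LINT t|M. indicator A t * (u * \<psi> t - \<kappa> u)) = (LINT t|M. u * (indicator A t * \<psi> t) - \<kappa> u * indicator A t)"
    by (intro Bochner_Integration.integral_cong) (auto simp: algebra_simps)
  also have "\<dots> = u * (LINT t:A|M. \<psi> t) - \<kappa> u * measure M A"
    using integrable_mult_indicator[OF A \<psi>] integrable_real_indicator[OF A] A
    by (subst Bochner_Integration.integral_diff) (auto simp: less_top[symmetric] set_lebesgue_integral_def Int_absorb2 sets.sets_into_space)
  also have "(LINT t|M. indicator (A \<inter> E) t * (2 * C * b t)) = 2 * C * (LINT t:A \<inter> E|M. b t)"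
    by (simp add: set_lebesgue_integral_def mult.left_commute flip: integral_mult_right_zero)
  finally show ?thesis .
qed

lemma emeasure_density_integral:
  fixes f :: "'b \<Rightarrow> real"
  assumes f: "integrable M f" and nn: "\<And>t. 0 \<le> f t" and A: "A \<in> sets M"
  shows "emeasure (density M (\<lambda>t. ennreal (f t))) A = ennreal (LINT t:A|M. f t)"
proof -
  have "emeasure (density M (\<lambda>t. ennreal (f t))) A = (\<integral>\<^sup>+ t. ennreal (indicator A t * f t) \<partial>M)"
    using f A by (subst emeasure_density) (auto intro!: nn_integral_cong split: split_indicator)
  also have "\<dots> = ennreal (LINT t|M. indicator A t * f t)"
    using integrable_mult_indicator[OF A f] nn by (intro nn_integral_eq_integral) auto
  finally show ?thesis by (simp add: set_lebesgue_integral_def)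
qed

text \<open>Test with the subsets of \<open>B\<close> on which \<open>f\<close> has a fixed sign.\<close>

lemma AE_zero_of_set_integrals:
  fixes f :: "'a \<Rightarrow> real"
  assumes f: "integrable M f" and B: "B \<in> sets M"
    and zero: "\<And>A. A \<in> sets M \<Longrightarrow> A \<subseteq> B \<Longrightarrow> (LINT t:A|M. f t) = 0"
  shows "AE t in M. t \<in> B \<longrightarrow> f t = 0"
proof -
  have [measurable]: "f \<in> borel_measurable M" "B \<in> sets M" using f B by auto
  have sign: "AE t in M. t \<in> B \<longrightarrow> c * f t \<le> 0" if "c = 1 \<or> c = -1" for c
  proof -
    define A where "A = {t \<in> space M. t \<in> B \<and> 0 < c * f t}"
    have A: "A \<in> sets M" unfolding A_def by measurable
    have int: "integrable M (\<lambda>t. indicator A t * (c * f t))"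
      using integrable_mult_indicator[OF A, of "\<lambda>t. c * f t"] f by simp
    have "(LINT t|M. indicator A t * (c * f t)) = c * (LINT t:A|M. f t)"
      by (simp add: set_lebesgue_integral_def mult.left_commute flip: integral_mult_right_zero)
    also have "\<dots> = 0" using zero[OF A] by (auto simp: A_def)
    finally have "AE t in M. indicator A t * (c * f t) = 0"
      by (subst integral_nonneg_eq_0_iff_AE[OF int, symmetric]) (auto simp: A_def split: split_indicator)
    then show ?thesis
      by (rule AE_mp) (intro AE_I2, auto simp: A_def split: split_indicator_asm)
  qed
  have "AE t in M. t \<in> B \<longrightarrow> 1 * f t \<le> 0" "AE t in M. t \<in> B \<longrightarrow> -1 * f t \<le> 0"
    by (rule sign, simp)+
  then show ?thesis by eventually_elim auto
qed

section \<open>Greedy selection from a sequence\<close>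

text \<open>A maximiser of \<open>\<phi>\<close> among \<open>e 0\<close>, \<dots>, \<open>e n\<close>, updated only on strict improvement. When \<open>\<phi>\<close> depends
  measurably on a parameter, each update is a case distinction over a measurable set, so the
  maximiser is measurable in the parameter.\<close>

primrec best_upto :: "(nat \<Rightarrow> real) \<Rightarrow> (real \<Rightarrow> real) \<Rightarrow> nat \<Rightarrow> real" where
  "best_upto e \<phi> 0 = e 0"
| "best_upto e \<phi> (Suc n) = (if \<phi> (best_upto e \<phi> n) < \<phi> (e (Suc n)) then e (Suc n) else best_upto e \<phi> n)"

lemma best_upto_mem: "best_upto e \<phi> n \<in> e ` {..n}"
  by (induction n) (auto simp: atMost_Suc)

lemma best_upto_ge: "i \<le> n \<Longrightarrow> \<phi> (e i) \<le> \<phi> (best_upto e \<phi> n)"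
  by (induction n) (auto simp: le_Suc_eq intro: order_trans)

lemma best_upto_mono: "mono (\<lambda>n. \<phi> (best_upto e \<phi> n))"
  by (rule mono_iff_le_Suc[THEN iffD2]) auto

lemma SUP_best_upto: "(SUP n. e2ennreal (ereal (\<phi> (best_upto e \<phi> n)))) = (SUP n. e2ennreal (ereal (\<phi> (e n))))"
proof (rule antisym)
  show "(SUP n. e2ennreal (ereal (\<phi> (best_upto e \<phi> n)))) \<le> (SUP n. e2ennreal (ereal (\<phi> (e n))))"
  proof (rule SUP_least)
    fix n
    obtain i where "best_upto e \<phi> n = e i" using best_upto_mem[of e \<phi> n] by blast
    then show "e2ennreal (ereal (\<phi> (best_upto e \<phi> n))) \<le> (SUP n. e2ennreal (ereal (\<phi> (e n))))"
      by (metis SUP_upper UNIV_I)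
  qed
  show "(SUP n. e2ennreal (ereal (\<phi> (e n)))) \<le> (SUP n. e2ennreal (ereal (\<phi> (best_upto e \<phi> n))))"
    by (intro SUP_mono) (metis UNIV_I best_upto_ge e2ennreal_mono ereal_less_eq(3) order_refl)
qed

section \<open>The integrals bound the rate function\<close>

locale decomposed_path = cost_function J h k c
  for J :: "real set" and h :: "real \<Rightarrow> ereal" and k :: "real \<Rightarrow> real" and c :: real +
  fixes T :: real and x :: "real \<Rightarrow> real" and dx :: "real set \<Rightarrow> real" and xdot :: "real \<Rightarrow> real"
    and \<nu> :: "real set \<Rightarrow> real" and \<theta> :: "real measure" and g :: "real \<Rightarrow> real"
  assumes T: "0 < T"
    and path: "path_measure T x dx"
    and decomposition: "lebesgue_decomposition T dx xdot \<nu>"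
    and finite_\<theta>: "finite_measure \<theta>"
    and sets_\<theta>: "sets \<theta> = sets (lebesgue_upto T)"
    and density_\<nu>: "is_density \<theta> \<nu> g"
begin

abbreviation L :: "real measure" where "L \<equiv> lebesgue_upto T"

lemma space_L: "space L = {0..T}" by (simp add: space_restrict_space)

lemma space_\<theta>: "space \<theta> = {0..T}" using sets_eq_imp_space_eq[OF sets_\<theta>] space_L by simp

lemma sets_L: "A \<in> sets L \<longleftrightarrow> A \<in> sets borel \<and> A \<subseteq> {0..T}"
  by (subst sets_restrict_space_iff) auto

lemma measurable_\<theta>: "borel_measurable \<theta> = borel_measurable L"
  by (rule measurable_cong_sets[OF sets_\<theta> refl])

lemma finite_L: "finite_measure L"
  using T by (intro finite_measureI) (simp add: space_L emeasure_restrict_space)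

lemma measure_L: "A \<in> sets L \<Longrightarrow> measure L A = measure lborel A"
  by (simp add: measure_restrict_space sets_L)

lemma xdot: "integrable L xdot" and g: "integrable \<theta> g"
  using decomposition density_\<nu> by (auto simp: lebesgue_decomposition_def is_density_def)

lemma dx_eq:
  assumes "A \<in> sets L"
  shows "dx A = (LINT t:A|L. xdot t) + (LINT t:A|\<theta>. g t)"
  using assms decomposition density_\<nu> sets_\<theta> by (auto simp: lebesgue_decomposition_def is_density_def)

lemma dx_Un:
  assumes "A \<in> sets L" "B \<in> sets L" "A \<inter> B = {}"
  shows "dx (A \<union> B) = dx A + dx B"
proof -
  have "set_integrable L A xdot" "set_integrable L B xdot"
    using integrable_mult_indicator[OF assms(1) xdot] integrable_mult_indicator[OF assms(2) xdot]
    by (simp_all add: set_integrable_def)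
  moreover have "set_integrable \<theta> A g" "set_integrable \<theta> B g"
    using assms(1,2) integrable_mult_indicator[OF _ g, of A] integrable_mult_indicator[OF _ g, of B]
    by (simp_all add: set_integrable_def sets_\<theta>)
  ultimately show ?thesis
    using assms by (simp add: dx_eq set_integral_Un)
qed

text \<open>A path may take any value between its one-sided limits at a jump, so a fraction \<open>l\<close> of the atom
  at \<open>t\<close> has been collected at time \<open>t\<close>. At the final time the whole atom counts.\<close>

lemma path_value:
  assumes "t \<in> {0..T}"
  shows "\<exists>l\<in>{0..1}. x t - x 0 = dx {0..<t} + l * dx {t}"
proof -
  have m: "{0..<t} \<in> sets L" "{t} \<in> sets L" using assms by (auto simp: sets_L)
  have "{0..t} = {0..<t} \<union> {t}" using assms by auto
  then have split: "dx {0..t} = dx {0..<t} + dx {t}" using dx_Un[OF m] by simp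
  show ?thesis
  proof (cases "t < T")
    case True
    then have "x t - x 0 \<in> closed_segment (dx {0..<t}) (dx {0..t})"
      using path assms by (auto simp: path_measure_def)
    then obtain l where "0 \<le> l" "l \<le> 1" "x t - x 0 = (1 - l) * dx {0..<t} + l * dx {0..t}"
      by (auto simp: closed_segment_def)
    then show ?thesis by (intro bexI[of _ l]) (auto simp: split algebra_simps)
  next
    case False
    with assms have "t = T" by simp
    then show ?thesis using path split by (intro bexI[of _ 1]) (auto simp: path_measure_def)
  qed
qed

definition conj_density :: "real \<Rightarrow> ennreal" where "conj_density t = e2ennreal (conjugate J h (xdot t))"
definition support_density :: "real \<Rightarrow> ennreal" where "support_density t = e2ennreal (support (g t))"

lemma densities_measurable:
  "conj_density \<in> borel_measurable L" "support_density \<in> borel_measurable \<theta>"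
proof -
  obtain e :: "nat \<Rightarrow> real" where "e 0 = 0" "range e \<subseteq> J"
    and e: "\<And>y. conjugate J h y = (SUP n. ereal (e n * y - k (e n)))"
    "\<And>y. support y = (SUP n. ereal (e n * y))" 
    using dense_sequence by blast
  have [measurable]: "xdot \<in> borel_measurable L" "g \<in> borel_measurable \<theta>" using xdot g by auto
  show "conj_density \<in> borel_measurable L" unfolding conj_density_def e by measurable
  show "support_density \<in> borel_measurable \<theta>" unfolding support_density_def e by measurable
qed

text \<open>Let \<open>U\<close> be the finite measure whose total mass is the right-hand side. A position \<open>u\<close> earns at
  most \<open>U A\<close> from the part of \<open>dx\<close> on \<open>A\<close>. If only a fraction \<open>l\<close> of the atom of \<open>dx\<close> at the current
  time has been collected, the induction grants only the same fraction of the atom of \<open>U\<close>; the next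
  holding period collects the fraction \<open>1 - l\<close>. This costs nothing, because single points have no
  Lebesgue measure.\<close>

lemma strategy_le_integrals:
  assumes fin1: "(\<integral>\<^sup>+ t. conj_density t \<partial>L) < \<infinity>" and fin2: "(\<integral>\<^sup>+ t. support_density t \<partial>\<theta>) < \<infinity>"
    and sv: "strategy_value J k T x b v"
  shows "ennreal v \<le> (\<integral>\<^sup>+ t. conj_density t \<partial>L) + (\<integral>\<^sup>+ t. support_density t \<partial>\<theta>)"
proof -
  let ?M1 = "density L conj_density" and ?M2 = "density \<theta> support_density"
  define U where "U = (\<lambda>A. measure ?M1 A + measure ?M2 A)"
  have total1: "emeasure ?M1 (space L) = (\<integral>\<^sup>+ t. conj_density t \<partial>L)"
    by (subst emeasure_density[OF densities_measurable(1) sets.top]) (auto intro!: nn_integral_cong)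
  have total2: "emeasure ?M2 (space \<theta>) = (\<integral>\<^sup>+ t. support_density t \<partial>\<theta>)"
    by (subst emeasure_density[OF densities_measurable(2) sets.top]) (auto intro!: nn_integral_cong)
  interpret M1: finite_measure ?M1 using total1 fin1 by (intro finite_measureI) auto
  interpret M2: finite_measure ?M2 using total2 fin2 by (intro finite_measureI) auto
  have U_nonneg: "0 \<le> U A" for A by (simp add: U_def)
  have U_Un: "U (A \<union> B) = U A + U B" if "A \<in> sets L" "B \<in> sets L" "A \<inter> B = {}" for A B
    using that by (simp add: U_def M1.finite_measure_Union M2.finite_measure_Union sets_\<theta>)
  have charge: "u * dx A - k u * measure L A \<le> U A" if u: "u \<in> J" and A: "A \<in> sets L" for u A
  proof -
    interpret finite_measure L by (rule finite_L)
    have A': "A \<in> sets \<theta>" using A sets_\<theta> by simp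
    have "(LINT t:A|L. u * xdot t - k u) \<le> measure ?M1 A"
    proof (rule integral_le_measure_density[OF _ densities_measurable(1) _ fin1 A])
      show "integrable L (\<lambda>t. u * xdot t - k u)" using xdot by simp
      show "ennreal (u * xdot t - k u) \<le> conj_density t" for t
        unfolding conj_density_def conjugate_eq e2ennreal_ereal[symmetric]
        using u by (intro e2ennreal_mono SUP_upper)
    qed
    moreover have "(LINT t:A|L. u * xdot t - k u) = u * (LINT t:A|L. xdot t) - k u * measure L A"
    proof -
      have 1: "set_integrable L A (\<lambda>t. u * xdot t)" "set_integrable L A (\<lambda>t. k u)"
        using integrable_mult_indicator[OF A, of "\<lambda>t. u * xdot t"] integrable_mult_indicator[OF A, of "\<lambda>t. k u"] xdot
        by (simp_all add: set_integrable_def)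
      show ?thesis
        by (subst set_integral_diff(2)[OF 1])
          (use A in \<open>simp add: set_lebesgue_integral_def Int_absorb2 sets_L\<close>)
    qed
    moreover have "(LINT t:A|\<theta>. u * g t) \<le> measure ?M2 A"
    proof (rule integral_le_measure_density[OF _ densities_measurable(2) _ fin2 A'])
      show "integrable \<theta> (\<lambda>t. u * g t)" using g by simp
      show "ennreal (u * g t) \<le> support_density t" for t
        unfolding support_density_def support_def e2ennreal_ereal[symmetric]
        using u by (intro e2ennreal_mono SUP_upper)
    qed
    ultimately show ?thesis by (simp add: dx_eq[OF A] U_def algebra_simps)
  qed
  have point: "u * dx {t} \<le> U {t}" if "u \<in> J" "t \<in> {0..T}" for u t
    using charge[OF that(1), of "{t}"] that(2) by (simp add: sets_L measure_L)
  have "0 \<le> b \<and> b \<le> T \<and> (\<exists>l\<in>{0..1}. x b - x 0 = dx {0..<b} + l * dx {b} \<and> v \<le> U {0..<b} + l * U {b})"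
    using sv
  proof induction
    case start
    have "dx {} = 0" using dx_eq[of "{}"] by (simp add: set_lebesgue_integral_def)
    then show ?case using T U_nonneg by (auto intro!: bexI[of _ 0])
  next
    case (advance a v b u)
    from advance.IH obtain l where a: "0 \<le> a" "a \<le> T" and l: "l \<in> {0..1}"
      and xa: "x a - x 0 = dx {0..<a} + l * dx {a}" and v: "v \<le> U {0..<a} + l * U {a}" by blast
    have b: "b \<in> {0..T}" using a advance.hyps by auto
    obtain l' where l': "l' \<in> {0..1}" and xb: "x b - x 0 = dx {0..<b} + l' * dx {b}"
      using path_value[OF b] by blast
    have m: "{0..<a} \<in> sets L" "{a} \<in> sets L" "{a<..<b} \<in> sets L"
      using a b by (auto simp: sets_L)
    have cell: "{0..<b} = ({0..<a} \<union> {a}) \<union> {a<..<b}" using a advance.hyps by auto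
    have disj: "{0..<a} \<inter> {a} = {}" "({0..<a} \<union> {a}) \<inter> {a<..<b} = {}" by auto
    have dx_cell: "dx {0..<b} = dx {0..<a} + dx {a} + dx {a<..<b}"
      unfolding cell using dx_Un[OF sets.Un[OF m(1,2)] m(3) disj(2)] dx_Un[OF m(1,2) disj(1)] by simp
    have U_cell: "U {0..<b} = U {0..<a} + U {a} + U {a<..<b}"
      unfolding cell using U_Un[OF sets.Un[OF m(1,2)] m(3) disj(2)] U_Un[OF m(1,2) disj(1)] by simp
    have "u * (x b - x a) = u * ((x b - x 0) - (x a - x 0))" by simp
    also have "\<dots> = (1 - l) * (u * dx {a}) + u * dx {a<..<b} + l' * (u * dx {b})"
      unfolding xa xb dx_cell by (simp add: algebra_simps)
    finally have gain: "u * (x b - x a) = (1 - l) * (u * dx {a}) + u * dx {a<..<b} + l' * (u * dx {b})" .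
    have "(1 - l) * (u * dx {a}) \<le> (1 - l) * U {a}"
      using l point[OF advance.hyps(4)] a by (intro mult_left_mono) auto
    moreover have "l' * (u * dx {b}) \<le> l' * U {b}"
      using l' point[OF advance.hyps(4) b] by (intro mult_left_mono) auto
    moreover have "u * dx {a<..<b} - (b - a) * k u \<le> U {a<..<b}"
      using charge[OF advance.hyps(4) m(3)] advance.hyps(2) m(3) by (simp add: measure_L mult.commute)
    ultimately have "v + u * (x b - x a) - (b - a) * k u \<le> U {0..<b} + l' * U {b}"
      using v unfolding gain U_cell by (simp add: algebra_simps)
    then show ?case using b l' xb by auto
  qed
  then obtain l where b: "0 \<le> b" "b \<le> T" and l: "l \<in> {0..1}" and v: "v \<le> U {0..<b} + l * U {b}" by blast
  have m: "{0..<b} \<in> sets L" "{b} \<in> sets L" "{b<..T} \<in> sets L" using b by (auto simp: sets_L)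
  have "{0..T} = ({0..<b} \<union> {b}) \<union> {b<..T}" using b by auto
  moreover have "({0..<b} \<union> {b}) \<inter> {b<..T} = {}" "{0..<b} \<inter> {b} = {}" by auto
  ultimately have "U {0..T} = U {0..<b} + U {b} + U {b<..T}"
    using U_Un[OF sets.Un[OF m(1,2)] m(3)] U_Un[OF m(1,2)] by (simp only:)
  moreover have "l * U {b} \<le> 1 * U {b}" using l U_nonneg by (intro mult_right_mono) auto
  ultimately have "v \<le> U {0..T}" using v U_nonneg[of "{b<..T}"] by simp
  then have "ennreal v \<le> ennreal (U {0..T})" by (rule ennreal_leI)
  also have "\<dots> = emeasure ?M1 (space L) + emeasure ?M2 (space \<theta>)"
    by (simp add: U_def space_L space_\<theta> M1.emeasure_eq_measure M2.emeasure_eq_measure)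
  finally show ?thesis unfolding total1 total2 .
qed

section \<open>The rate function bounds the integrals\<close>

text \<open>The sum of the measures \<open>(1 + \<bar>xdot t\<bar>) dt\<close> and \<open>\<bar>g t\<bar> d\<theta>\<close>. Up to a constant it dominates
  the profit and the running cost of a bounded position, so it is the measure in which positions are approximated.\<close>

definition charge_bound :: "real measure" where
  "charge_bound = measure_of {0..T} (sets L)
     (\<lambda>A. emeasure (density L (\<lambda>t. ennreal (1 + \<bar>xdot t\<bar>))) A + emeasure (density \<theta> (\<lambda>t. ennreal \<bar>g t\<bar>)) A)"

lemma sets_charge_bound: "sets charge_bound = sets L"
  unfolding charge_bound_def by (metis sets.sets_measure_of_eq space_L)

lemma emeasure_charge_bound:
  assumes "A \<in> sets L"
  shows "emeasure charge_bound A =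
    emeasure (density L (\<lambda>t. ennreal (1 + \<bar>xdot t\<bar>))) A + emeasure (density \<theta> (\<lambda>t. ennreal \<bar>g t\<bar>)) A"
  unfolding charge_bound_def
proof (rule emeasure_measure_of_sigma)
  show "sigma_algebra {0..T} (sets L)" by (metis sets.sigma_algebra_axioms space_L)
  show "positive (sets L) (\<lambda>A. emeasure (density L (\<lambda>t. ennreal (1 + \<bar>xdot t\<bar>))) A + emeasure (density \<theta> (\<lambda>t. ennreal \<bar>g t\<bar>)) A)"
    by (simp add: positive_def)
  show "countably_additive (sets L) (\<lambda>A. emeasure (density L (\<lambda>t. ennreal (1 + \<bar>xdot t\<bar>))) A + emeasure (density \<theta> (\<lambda>t. ennreal \<bar>g t\<bar>)) A)"
  proof (rule countably_additiveI)
    fix A :: "nat \<Rightarrow> real set" assume A: "range A \<subseteq> sets L" "disjoint_family A"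
    show "(\<Sum>i. emeasure (density L (\<lambda>t. ennreal (1 + \<bar>xdot t\<bar>))) (A i) + emeasure (density \<theta> (\<lambda>t. ennreal \<bar>g t\<bar>)) (A i)) =
      emeasure (density L (\<lambda>t. ennreal (1 + \<bar>xdot t\<bar>))) (\<Union>i. A i) + emeasure (density \<theta> (\<lambda>t. ennreal \<bar>g t\<bar>)) (\<Union>i. A i)"
      using A by (subst suminf_add[symmetric]) (auto simp: suminf_emeasure sets_\<theta> intro!: summableI)
  qed
qed (rule assms)

lemma integrable_bounds: "integrable L (\<lambda>t. 1 + \<bar>xdot t\<bar>)" "integrable \<theta> (\<lambda>t. \<bar>g t\<bar>)"
proof -
  interpret finite_measure L by (rule finite_L)
  show "integrable L (\<lambda>t. 1 + \<bar>xdot t\<bar>)" "integrable \<theta> (\<lambda>t. \<bar>g t\<bar>)" using xdot g by simp_all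
qed

lemma measure_charge_bound:
  assumes A: "A \<in> sets L"
  shows "measure charge_bound A = (LINT t:A|L. 1 + \<bar>xdot t\<bar>) + (LINT t:A|\<theta>. \<bar>g t\<bar>)"
    and "emeasure charge_bound A < \<infinity>"
proof -
  have nn: "0 \<le> (LINT t:A|L. 1 + \<bar>xdot t\<bar>)" "0 \<le> (LINT t:A|\<theta>. \<bar>g t\<bar>)"
    by (simp_all add: set_lebesgue_integral_def integral_nonneg_AE)
  have eq: "emeasure charge_bound A = ennreal ((LINT t:A|L. 1 + \<bar>xdot t\<bar>) + (LINT t:A|\<theta>. \<bar>g t\<bar>))"
  proof -
    have "A \<in> sets \<theta>" using A sets_\<theta> by simp
    from emeasure_density_integral[OF integrable_bounds(1) _ A] emeasure_density_integral[OF integrable_bounds(2) _ this]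
    show ?thesis
      unfolding emeasure_charge_bound[OF A] ennreal_plus[OF nn] by simp
  qed
  show "measure charge_bound A = (LINT t:A|L. 1 + \<bar>xdot t\<bar>) + (LINT t:A|\<theta>. \<bar>g t\<bar>)"
    unfolding measure_def eq by (rule enn2real_ennreal) (use nn in simp)
  show "emeasure charge_bound A < \<infinity>" unfolding eq by simp
qed

lemma finite_charge_bound: "finite_measure charge_bound"
proof (rule finite_measureI)
  have "space charge_bound \<in> sets L" using sets_charge_bound by (metis sets.top)
  then show "emeasure charge_bound (space charge_bound) \<noteq> \<infinity>" using measure_charge_bound(2) by force
qed

lemma dx_bound: "A \<in> sets L \<Longrightarrow> \<bar>dx A\<bar> \<le> measure charge_bound A"
proof -
  assume A: "A \<in> sets L"
  have A': "A \<in> sets \<theta>" using A sets_\<theta> by simp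
  have "\<bar>LINT t:A|L. xdot t\<bar> \<le> (LINT t:A|L. 1 + \<bar>xdot t\<bar>)"
  proof -
    have "\<bar>LINT t:A|L. xdot t\<bar> \<le> (LINT t|L. \<bar>indicator A t * xdot t\<bar>)"
      unfolding set_lebesgue_integral_def by (simp add: integral_abs_bound)
    also have "\<dots> \<le> (LINT t|L. indicator A t * (1 + \<bar>xdot t\<bar>))"
      using integrable_mult_indicator[OF A xdot] integrable_mult_indicator[OF A integrable_bounds(1)]
      by (intro integral_mono) (auto split: split_indicator)
    finally show ?thesis by (simp add: set_lebesgue_integral_def)
  qed
  moreover have "\<bar>LINT t:A|\<theta>. g t\<bar> \<le> (LINT t:A|\<theta>. \<bar>g t\<bar>)"
  proof -
    have "\<bar>LINT t:A|\<theta>. g t\<bar> \<le> (LINT t|\<theta>. \<bar>indicator A t * g t\<bar>)"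
      unfolding set_lebesgue_integral_def by (simp add: integral_abs_bound)
    then show ?thesis by (simp add: set_lebesgue_integral_def abs_mult)
  qed
  ultimately show ?thesis unfolding dx_eq[OF A] measure_charge_bound(1)[OF A] by linarith
qed

definition gain :: "(real \<Rightarrow> real) \<Rightarrow> real set \<Rightarrow> real" where
  "gain f A = (LINT t:A|L. f t * xdot t - k (f t)) + (LINT t:A|\<theta>. f t * g t)"

lemma selection_integrable:
  assumes f: "f \<in> borel_measurable L" "(\<lambda>t. k (f t)) \<in> borel_measurable L"
    and bound: "\<And>t. \<bar>f t\<bar> \<le> B" "\<And>t. \<bar>k (f t)\<bar> \<le> B"
  shows "integrable L (\<lambda>t. f t * xdot t - k (f t))" "integrable \<theta> (\<lambda>t. f t * g t)"
proof -
  interpret finite_measure L by (rule finite_L)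
  have le: "norm (f t * y) \<le> norm (B * \<bar>y\<bar>)" for t y
    using bound(1)[of t] by (simp add: abs_mult mult_right_mono)
  have f': "f \<in> borel_measurable \<theta>" using f(1) by (simp add: measurable_\<theta>)
  have "integrable L (\<lambda>t. f t * xdot t)"
  proof (rule Bochner_Integration.integrable_bound)
    show "integrable L (\<lambda>t. B * \<bar>xdot t\<bar>)" using xdot by simp
    show "(\<lambda>t. f t * xdot t) \<in> borel_measurable L" using f xdot by measurable
    show "AE t in L. norm (f t * xdot t) \<le> norm (B * \<bar>xdot t\<bar>)"
      using le by simp
  qed
  moreover have "integrable L (\<lambda>t. k (f t))"
    using f bound(2) by (intro integrable_const_bound[of _ B]) auto
  ultimately show "integrable L (\<lambda>t. f t * xdot t - k (f t))" by simp
  show "integrable \<theta> (\<lambda>t. f t * g t)"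
  proof (rule Bochner_Integration.integrable_bound)
    show "integrable \<theta> (\<lambda>t. B * \<bar>g t\<bar>)" using g by simp
    show "(\<lambda>t. f t * g t) \<in> borel_measurable \<theta>" using f' g by measurable
    show "AE t in \<theta>. norm (f t * g t) \<le> norm (B * \<bar>g t\<bar>)"
      using le by simp
  qed
qed

text \<open>Approximate the position by a step function that differs from it on a set of small
  \<open>charge_bound\<close>. The step function is a strategy: its switching times are not atoms of \<open>dx\<close>, so the
  increment of \<open>x\<close> over a cell is \<open>dx\<close> of that cell. The loss is accounted for cell by cell,
  proceeding from each switching time to the next.\<close>

lemma gain_le_path_rate:
  assumes f: "f \<in> borel_measurable L" "(\<lambda>t. k (f t)) \<in> borel_measurable L"
    and K: "finite K" "K \<subseteq> J" "\<And>t. f t \<in> K" and approx: "approximable charge_bound T K f"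
  shows "ereal (gain f {0..T}) \<le> path_rate J h T x"
proof -
  interpret cb: finite_measure charge_bound by (rule finite_charge_bound)
  define B where "B = Max ((\<lambda>u. max \<bar>u\<bar> \<bar>k u\<bar>) ` K)"
  have B: "\<bar>u\<bar> \<le> B" "\<bar>k u\<bar> \<le> B" if "u \<in> K" for u
  proof -
    have "max \<bar>u\<bar> \<bar>k u\<bar> \<le> B" unfolding B_def using K(1) that by (intro Max_ge) auto
    then show "\<bar>u\<bar> \<le> B" "\<bar>k u\<bar> \<le> B" by auto
  qed
  have B0: "0 \<le> B" using B(1)[OF K(3)[of 0]] by linarith
  note int = selection_integrable[OF f B(1)[OF K(3)] B(2)[OF K(3)]]
  have gain_Un: "gain f (A \<union> A') = gain f A + gain f A'" if "A \<in> sets L" "A' \<in> sets L" "A \<inter> A' = {}" for A A'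
  proof -
    have "set_integrable L A (\<lambda>t. f t * xdot t - k (f t))" "set_integrable L A' (\<lambda>t. f t * xdot t - k (f t))"
      unfolding set_integrable_def using that int(1) by (auto intro!: integrable_mult_indicator simp del: real_scaleR_def)
    moreover have "set_integrable \<theta> A (\<lambda>t. f t * g t)" "set_integrable \<theta> A' (\<lambda>t. f t * g t)"
      unfolding set_integrable_def using that int(2) by (auto intro!: integrable_mult_indicator simp: sets_\<theta> simp del: real_scaleR_def)
    ultimately show ?thesis unfolding gain_def using that(3) by (simp add: set_integral_Un)
  qed
  have cell: "gain f A \<le> u * dx A - k u * measure L A + 2 * B * measure charge_bound (A \<inter> E)"
    if A: "A \<in> sets L" and E: "E \<in> sets L" and u: "u \<in> K" and eq: "\<And>t. t \<in> A - E \<Longrightarrow> f t = u" for A E u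
  proof -
    have "(LINT t:A|L. f t * xdot t - k (f t)) \<le>
        u * (LINT t:A|L. xdot t) - k u * measure L A + 2 * B * (LINT t:A \<inter> E|L. 1 + \<bar>xdot t\<bar>)"
      by (rule cell_gain[OF int(1) xdot integrable_bounds(1) _ A E finite_L, where r = 1])
        (use B K(3) u eq in auto)
    moreover have "(LINT t:A|\<theta>. f t * g t - (\<lambda>_. 0) (f t)) \<le>
        u * (LINT t:A|\<theta>. g t) - (\<lambda>_. 0) u * measure \<theta> A + 2 * B * (LINT t:A \<inter> E|\<theta>. \<bar>g t\<bar>)"
      by (rule cell_gain[OF _ g integrable_bounds(2) _ _ _ finite_\<theta>, where r = 0])
        (use B B0 K(3) u eq int(2) A E in \<open>auto simp: sets_\<theta>\<close>)
    ultimately show ?thesis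
      unfolding gain_def dx_eq[OF A] measure_charge_bound(1)[OF sets.Int[OF A E]]
      by (simp add: algebra_simps)
  qed
  have approx_bound: "ereal (gain f {0..T} - 2 * B * \<epsilon>) \<le> path_rate J h T x" if \<epsilon>: "0 < \<epsilon>" for \<epsilon>
  proof -
    obtain D s E where D: "finite D" "D \<subseteq> {0<..<T}" "\<forall>d\<in>D. measure charge_bound {d} = 0"
      and s: "piecewise_constant T D s" "s ` {0..T} \<subseteq> K"
      and E: "E \<in> sets charge_bound" "\<forall>t\<in>{0..T} - E. s t = f t" "measure charge_bound E < \<epsilon>"
      using approx \<epsilon> unfolding approximable_def by metis
    have EL: "E \<in> sets L" using E(1) sets_charge_bound by simp
    have good: "x b - x 0 = dx {0..b}" if b: "b \<in> insert T D" for b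
    proof (cases "b = T")
      case True
      then show ?thesis using path by (simp add: path_measure_def)
    next
      case False
      with b D have bT: "b \<in> D" "0 < b" "b < T" by auto
      then have m: "{0..<b} \<in> sets L" "{b} \<in> sets L" by (auto simp: sets_L)
      have "dx {b} = 0" using dx_bound[OF m(2)] D(3) bT(1) by auto
      moreover have "{0..b} = {0..<b} \<union> {b}" using bT by auto
      ultimately have "dx {0..b} = dx {0..<b}" "dx {b} = 0" using dx_Un[OF m] by auto
      with path_value[of b] bT show ?thesis by auto
    qed
    \<comment> \<open>Induction on the number of switching times before \<open>b\<close>.\<close>
    have reach: "\<exists>v. strategy_value J k T x b v \<and> gain f {0..b} - 2 * B * measure charge_bound (E \<inter> {0..b}) \<le> v"
      if "b \<in> insert T D" for b
      using that
    proof (induction "card (D \<inter> {..<b})" arbitrary: b rule: less_induct)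
      case less
      have bT: "0 < b" "b \<le> T" using less.prems D(2) T by auto
      have sb: "s b \<in> K" using s(2) bT by auto
      show ?case
      proof (cases "D \<inter> {..<b} = {}")
        case True
        have m: "{0..b} \<in> sets L" using bT by (auto simp: sets_L)
        have const: "s t = s b" if "t \<in> {0..b}" for t
        proof -
          have "0 \<le> t \<and> t \<le> b \<and> b \<le> T \<and> D \<inter> {t..<b} = {}" using that bT True by auto
          then show ?thesis using s(1) unfolding piecewise_constant_def by blast
        qed
        have "f t = s b" if "t \<in> {0..b} - E" for t
          using const[of t] E(2) that bT by simp
        note cell[OF m EL sb this]
        moreover have "measure L {0..b} = b" using m bT by (simp add: measure_L)
        moreover have "{0..b} \<inter> E = E \<inter> {0..b}" by auto
        ultimately have "gain f {0..b} - 2 * B * measure charge_bound (E \<inter> {0..b}) \<le>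
            0 + s b * (x b - x 0) - (b - 0) * k (s b)"
          by (simp add: good[OF less.prems] mult.commute)
        moreover have "strategy_value J k T x b (0 + s b * (x b - x 0) - (b - 0) * k (s b))"
          using sb K(2) bT by (intro strategy_value.advance strategy_value.start) auto
        ultimately show ?thesis by blast
      next
        case False
        define a where "a = Max (D \<inter> {..<b})"
        have "a \<in> D \<inter> {..<b}" unfolding a_def using False D(1) by (intro Max_in) auto
        then have a: "a \<in> D" "a < b" "0 < a" "a < T" using D(2) by auto
        have gap: "D \<inter> {t..<b} = {}" if "a < t" for t
        proof (rule ccontr)
          assume "D \<inter> {t..<b} \<noteq> {}"
          then obtain d where "d \<in> D" "t \<le> d" "d < b" by auto
          then have "d \<le> a" unfolding a_def using D(1) by (intro Max_ge) auto
          with \<open>t \<le> d\<close> that show False by simp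
        qed
        have "D \<inter> {..<a} \<subset> D \<inter> {..<b}" using a by auto
        then have "card (D \<inter> {..<a}) < card (D \<inter> {..<b})" using D(1) by (intro psubset_card_mono) auto
        from less.hyps[OF this] a obtain v where v: "strategy_value J k T x a v"
          "gain f {0..a} - 2 * B * measure charge_bound (E \<inter> {0..a}) \<le> v" by blast
        have m: "{0..a} \<in> sets L" "{a<..b} \<in> sets L" using a bT by (auto simp: sets_L)
        have split: "{0..b} = {0..a} \<union> {a<..b}" "{0..a} \<inter> {a<..b} = {}" using a by auto
        have const: "s t = s b" if "t \<in> {a<..b}" for t
        proof -
          have "0 \<le> t \<and> t \<le> b \<and> b \<le> T \<and> D \<inter> {t..<b} = {}" using that bT gap[of t] a by auto
          then show ?thesis using s(1) unfolding piecewise_constant_def by blast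
        qed
        have "f t = s b" if "t \<in> {a<..b} - E" for t
          using const[of t] E(2) that bT a by simp
        note cell[OF m(2) EL sb this]
        moreover have "measure L {a<..b} = b - a" using m a by (simp add: measure_L)
        moreover have "dx {a<..b} = x b - x a"
        proof -
          have "dx {0..b} = dx {0..a} + dx {a<..b}" unfolding split(1) by (rule dx_Un[OF m split(2)])
          moreover have "x a - x 0 = dx {0..a}" using good a by simp
          ultimately show ?thesis using good[OF less.prems] by simp
        qed
        moreover have "gain f {0..b} = gain f {0..a} + gain f {a<..b}"
          unfolding split(1) by (rule gain_Un[OF m split(2)])
        moreover have "measure charge_bound (E \<inter> {0..b}) =
            measure charge_bound (E \<inter> {0..a}) + measure charge_bound ({a<..b} \<inter> E)"
        proof -
          have "E \<inter> {0..b} = (E \<inter> {0..a}) \<union> ({a<..b} \<inter> E)" using split(1) by auto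
          then show ?thesis
            using EL m split(2) by (simp only:) (rule cb.finite_measure_Union, auto simp: sets_charge_bound)
        qed
        ultimately have "gain f {0..b} - 2 * B * measure charge_bound (E \<inter> {0..b}) \<le>
            v + s b * (x b - x a) - (b - a) * k (s b)"
          using v(2) by (simp add: algebra_simps)
        moreover have "strategy_value J k T x b (v + s b * (x b - x a) - (b - a) * k (s b))"
          using sb K(2) bT a v(1) by (intro strategy_value.advance) auto
        ultimately show ?thesis by blast
      qed
    qed
    obtain v where v: "strategy_value J k T x T v"
      "gain f {0..T} - 2 * B * measure charge_bound (E \<inter> {0..T}) \<le> v" using reach[of T] by blast
    have "measure charge_bound (E \<inter> {0..T}) \<le> \<epsilon>"
      using E(1,3) cb.finite_measure_mono[of "E \<inter> {0..T}" E] by simp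
    then have "2 * B * measure charge_bound (E \<inter> {0..T}) \<le> 2 * B * \<epsilon>" using B0 by (intro mult_left_mono) auto
    with v(2) have "ereal (gain f {0..T} - 2 * B * \<epsilon>) \<le> ereal v" by simp
    also have "\<dots> \<le> path_rate J h T x" by (rule strategy_le_path_rate[OF T v(1)])
    finally show ?thesis .
  qed
  have "((\<lambda>\<epsilon>. ereal (gain f {0..T} - 2 * B * \<epsilon>)) \<longlongrightarrow> ereal (gain f {0..T} - 2 * B * 0)) (at_right 0)"
    by (intro tendsto_intros)
  moreover have "\<forall>\<^sub>F \<epsilon> in at_right 0. ereal (gain f {0..T} - 2 * B * \<epsilon>) \<le> path_rate J h T x"
    using eventually_at_right_less[of 0] by eventually_elim (rule approx_bound)
  ultimately show ?thesis
    by (intro tendsto_upperbound[of _ _ "at_right (0::real)"]) auto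
qed

text \<open>On a Lebesgue null set \<open>N\<close> that carries \<open>\<nu>\<close> the running cost is invisible, so there the
  position maximises \<open>u * g t\<close>; elsewhere it maximises \<open>u * xdot t - k u\<close>. One measurable position thus
  attains both partial maxima, and these increase to the support function and to \<open>h\<^sup>*\<close>.\<close>

lemma integrals_le_path_rate:
  "(\<integral>\<^sup>+ t. conj_density t \<partial>L) + (\<integral>\<^sup>+ t. support_density t \<partial>\<theta>) \<le> e2ennreal (path_rate J h T x)"
proof -
  obtain e :: "nat \<Rightarrow> real" where e0: "e 0 = 0" and eJ: "range e \<subseteq> J"
    and e_conj: "\<And>y. conjugate J h y = (SUP n. ereal (e n * y - k (e n)))"
    and e_supp: "\<And>y. support y = (SUP n. ereal (e n * y))"
    using dense_sequence by blast
  obtain N where N: "N \<in> null_sets L" "\<And>A. A \<in> sets L \<Longrightarrow> A \<inter> N = {} \<Longrightarrow> \<nu> A = 0"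
    using decomposition by (auto simp: lebesgue_decomposition_def singular_to_def)
  have [measurable]: "xdot \<in> borel_measurable L" "g \<in> borel_measurable L" "N \<in> sets L"
    using xdot g N(1) measurable_\<theta> by auto
  have AE_L: "AE t in L. t \<notin> N" using N(1) by (rule AE_not_in)
  have AE_\<theta>: "AE t in \<theta>. t \<notin> N \<longrightarrow> g t = 0"
  proof -
    have "AE t in \<theta>. t \<in> space \<theta> - N \<longrightarrow> g t = 0"
    proof (rule AE_zero_of_set_integrals[OF g])
      show "space \<theta> - N \<in> sets \<theta>" using N(1) sets_\<theta> by auto
      fix A assume A: "A \<in> sets \<theta>" "A \<subseteq> space \<theta> - N"
      then have "\<nu> A = 0" using sets_\<theta> by (intro N(2)) auto
      then show "(LINT t:A|\<theta>. g t) = 0" using density_\<nu> A(1) by (simp add: is_density_def)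
    qed
    then show ?thesis by (rule AE_mp) (intro AE_I2, auto)
  qed
  define score where "score = (\<lambda>t u. if t \<in> N then u * g t else u * xdot t - k u)"
  define pick where "pick = (\<lambda>n t. best_upto e (score t) n)"
  have pick_mem: "pick n t \<in> e ` {..n}" for n t unfolding pick_def by (rule best_upto_mem)
  have score_meas: "(\<lambda>t. score t (f t)) \<in> borel_measurable L"
    if [measurable]: "f \<in> borel_measurable L" "(\<lambda>t. k (f t)) \<in> borel_measurable L" for f
    unfolding score_def by measurable
  have pick_ind: "pick n \<in> borel_measurable L \<and> (\<lambda>t. k (pick n t)) \<in> borel_measurable L \<and>
      approximable charge_bound T (e ` {..n}) (pick n)" for n
  proof (induction n)
    case 0
    have "pick 0 = (\<lambda>_. e 0)" by (simp add: pick_def fun_eq_iff)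
    then show ?case by (simp add: approximable_const)
  next
    case (Suc n)
    then have [measurable]: "pick n \<in> borel_measurable L" "(\<lambda>t. k (pick n t)) \<in> borel_measurable L" by auto
    define A where "A = {t \<in> space L. score t (pick n t) < score t (e (Suc n))}"
    have [measurable]: "(\<lambda>t. score t (pick n t)) \<in> borel_measurable L" "(\<lambda>t. score t (e (Suc n))) \<in> borel_measurable L"
      by (rule score_meas; measurable)+
    have A: "A \<in> sets L" unfolding A_def by measurable
    have eq: "pick (Suc n) t = (if t \<in> A then e (Suc n) else pick n t)" if "t \<in> space L" for t
      using that by (simp add: pick_def A_def)
    have "pick (Suc n) \<in> borel_measurable L"
      by (subst measurable_cong[OF eq]) (use A in measurable)
    moreover have "(\<lambda>t. k (pick (Suc n) t)) \<in> borel_measurable L"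
    proof -
      have "k (pick (Suc n) t) = (if t \<in> A then k (e (Suc n)) else k (pick n t))" if "t \<in> space L" for t
        using eq[OF that] by simp
      then show ?thesis by (subst measurable_cong) (use A in measurable)
    qed
    moreover have "approximable charge_bound T (e ` {..Suc n}) (pick (Suc n))"
    proof (rule approximable_limit[OF finite_charge_bound])
      fix \<epsilon> :: real assume "0 < \<epsilon>"
      have "approximable charge_bound T UNIV (\<lambda>t. t \<in> A)"
        using A by (intro approximable_borel finite_charge_bound) (auto simp: sets_charge_bound sets_L)
      then have "approximable charge_bound T (e ` {..Suc n}) (\<lambda>t. if t \<in> A then e (Suc n) else pick n t)"
        using Suc by (intro approximable_combine[OF finite_charge_bound,
              where F = "\<lambda>a b. if a then e (Suc n) else b"]) auto
      with \<open>0 < \<epsilon>\<close> show "\<exists>f' E'. approximable charge_bound T (e ` {..Suc n}) f' \<and> E' \<in> sets charge_bound \<and>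
          (\<forall>t\<in>{0..T} - E'. f' t = pick (Suc n) t) \<and> measure charge_bound E' < \<epsilon>"
        by (intro exI[of _ "\<lambda>t. if t \<in> A then e (Suc n) else pick n t"] exI[of _ "{}"])
          (auto simp: eq space_L)
    qed
    ultimately show ?case by blast
  qed
  define V where "V = (\<lambda>n t. pick n t * xdot t - k (pick n t))"
  define W where "W = (\<lambda>n t. pick n t * g t)"
  have score_nonneg: "0 \<le> score t (pick n t)" for n t
  proof -
    have "score t (e 0) = 0" by (simp add: score_def e0 cost_zero)
    then show ?thesis using best_upto_ge[of 0 n "score t" e] by (simp add: pick_def)
  qed
  have score_mono: "score t (pick m t) \<le> score t (pick n t)" if "m \<le> n" for m n t
    unfolding pick_def using best_upto_mono[of "score t" e] that by (rule monoD)
  \<comment> \<open>Each of the two integrands agrees with the maximised score only almost everywhere: \<open>N\<close> is Lebesgue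
    null, and \<open>g\<close> vanishes almost everywhere off \<open>N\<close>.\<close>
  have V_score: "AE t in L. V n t = score t (pick n t)" for n
    using AE_L by eventually_elim (simp add: V_def score_def)
  have W_score: "AE t in \<theta>. W n t = (if t \<in> N then score t (pick n t) else 0)" for n
    using AE_\<theta> by eventually_elim (auto simp: W_def score_def)
  have bounds: "\<exists>B. (\<forall>t. \<bar>pick n t\<bar> \<le> B) \<and> (\<forall>t. \<bar>k (pick n t)\<bar> \<le> B)" for n
  proof -
    define B where "B = Max ((\<lambda>i. max \<bar>e i\<bar> \<bar>k (e i)\<bar>) ` {..n})"
    have "max \<bar>pick n t\<bar> \<bar>k (pick n t)\<bar> \<le> B" for t
    proof -
      obtain i where "i \<le> n" "pick n t = e i" using pick_mem[of n t] by auto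
      then show ?thesis unfolding B_def by (intro Max_ge) auto
    qed
    then show ?thesis by (metis max.bounded_iff)
  qed
  have int: "integrable L (V n)" "integrable \<theta> (W n)" for n
  proof -
    obtain B where "\<And>t. \<bar>pick n t\<bar> \<le> B" "\<And>t. \<bar>k (pick n t)\<bar> \<le> B" using bounds[of n] by blast
    then show "integrable L (V n)" "integrable \<theta> (W n)"
      unfolding V_def W_def using pick_ind[of n] by (auto intro!: selection_integrable)
  qed
  have finite_gain: "(\<integral>\<^sup>+ t. ennreal (V n t) \<partial>L) + (\<integral>\<^sup>+ t. ennreal (W n t) \<partial>\<theta>) \<le> e2ennreal (path_rate J h T x)" for n
  proof -
    have nn: "AE t in L. 0 \<le> V n t" "AE t in \<theta>. 0 \<le> W n t"
      subgoal using V_score[of n] by eventually_elim (simp add: score_nonneg)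
      subgoal using W_score[of n] by eventually_elim (simp add: score_nonneg)
      done
    have "(\<integral>\<^sup>+ t. ennreal (V n t) \<partial>L) + (\<integral>\<^sup>+ t. ennreal (W n t) \<partial>\<theta>) =
        ennreal (LINT t|L. V n t) + ennreal (LINT t|\<theta>. W n t)"
      using int nn by (simp add: nn_integral_eq_integral)
    also have "\<dots> = ennreal ((LINT t|L. V n t) + (LINT t|\<theta>. W n t))"
      using nn by (intro ennreal_plus[symmetric] integral_nonneg_AE)
    also have "(LINT t|L. V n t) + (LINT t|\<theta>. W n t) = gain (pick n) {0..T}"
      unfolding gain_def V_def W_def set_lebesgue_integral_def
      by (intro arg_cong2[where f = "(+)"] Bochner_Integration.integral_cong) (auto simp: space_L space_\<theta>)
    also have "ennreal (gain (pick n) {0..T}) \<le> e2ennreal (path_rate J h T x)"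
      unfolding e2ennreal_ereal[symmetric]
      using pick_ind[of n] pick_mem eJ
      by (intro e2ennreal_mono gain_le_path_rate[of _ "e ` {..n}"]) auto
    finally show ?thesis .
  qed
  have SUP_score: "(SUP n. ennreal (score t (pick n t))) = (SUP n. ennreal (score t (e n)))" for t
    using SUP_best_upto[of "score t" e] by (simp add: pick_def)
  have e2_SUP: "e2ennreal (SUP n. ereal (s n)) = (SUP n. ennreal (s n))" if "s 0 = 0" for s :: "nat \<Rightarrow> real"
  proof -
    have nn: "0 \<le> (SUP n. ereal (s n))" using that by (intro SUP_upper2[of 0]) (auto simp: zero_ereal_def)
    show ?thesis
    proof (rule antisym)
      have "(SUP n. ereal (s n)) \<le> enn2ereal (SUP n. ennreal (s n))"
      proof (rule SUP_least)
        fix n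
        have "ereal (s n) \<le> enn2ereal (ennreal (s n))" by (simp add: enn2ereal_ennreal ennreal.rep_eq)
        also have "\<dots> \<le> enn2ereal (SUP n. ennreal (s n))"
          unfolding less_eq_ennreal.rep_eq[symmetric] by (rule SUP_upper) simp
        finally show "ereal (s n) \<le> enn2ereal (SUP n. ennreal (s n))" .
      qed
      then show "e2ennreal (SUP n. ereal (s n)) \<le> (SUP n. ennreal (s n))"
        using e2ennreal_mono by fastforce
      show "(SUP n. ennreal (s n)) \<le> e2ennreal (SUP n. ereal (s n))"
        unfolding e2ennreal_ereal[symmetric] by (intro SUP_least e2ennreal_mono SUP_upper) simp
    qed
  qed
  have V_lim: "(\<integral>\<^sup>+ t. conj_density t \<partial>L) = (SUP n. \<integral>\<^sup>+ t. ennreal (V n t) \<partial>L)"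
  proof -
    have all: "AE t in L. \<forall>n. V n t = score t (pick n t)" using V_score by (simp add: AE_all_countable)
    have "(\<integral>\<^sup>+ t. conj_density t \<partial>L) = (\<integral>\<^sup>+ t. (SUP n. ennreal (V n t)) \<partial>L)"
    proof (rule nn_integral_cong_AE)
      show "AE t in L. conj_density t = (SUP n. ennreal (V n t))"
        using all AE_L
      proof eventually_elim
        case (elim t)
        have "conj_density t = (SUP n. ennreal (e n * xdot t - k (e n)))"
          unfolding conj_density_def e_conj by (rule e2_SUP) (simp add: e0 cost_zero)
        also have "\<dots> = (SUP n. ennreal (score t (e n)))" using elim(2) by (simp add: score_def)
        also have "\<dots> = (SUP n. ennreal (V n t))" using elim(1) SUP_score by simp
        finally show ?case .
      qed
    qed
    also have "\<dots> = (SUP n. \<integral>\<^sup>+ t. ennreal (V n t) \<partial>L)"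
    proof (rule nn_integral_monotone_convergence_SUP_AE)
      show "AE t in L. ennreal (V n t) \<le> ennreal (V (Suc n) t)" for n
        using all by eventually_elim (auto intro!: ennreal_leI score_mono)
      show "(\<lambda>t. ennreal (V n t)) \<in> borel_measurable L" for n using int(1)[of n] by measurable
    qed
    finally show ?thesis .
  qed
  have W_lim: "(\<integral>\<^sup>+ t. support_density t \<partial>\<theta>) = (SUP n. \<integral>\<^sup>+ t. ennreal (W n t) \<partial>\<theta>)"
  proof -
    have all: "AE t in \<theta>. \<forall>n. W n t = (if t \<in> N then score t (pick n t) else 0)"
      using W_score by (simp add: AE_all_countable)
    have "(\<integral>\<^sup>+ t. support_density t \<partial>\<theta>) = (\<integral>\<^sup>+ t. (SUP n. ennreal (W n t)) \<partial>\<theta>)"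
    proof (rule nn_integral_cong_AE)
      show "AE t in \<theta>. support_density t = (SUP n. ennreal (W n t))"
        using all AE_\<theta>
      proof eventually_elim
        case (elim t)
        have supp: "support_density t = (SUP n. ennreal (e n * g t))"
          unfolding support_density_def e_supp by (rule e2_SUP) (simp add: e0)
        show ?case
        proof (cases "t \<in> N")
          case True
          then have "support_density t = (SUP n. ennreal (score t (e n)))" by (simp add: supp score_def)
          also have "\<dots> = (SUP n. ennreal (W n t))" using elim(1) SUP_score True by simp
          finally show ?thesis .
        next
          case False
          with elim supp show ?thesis by simp
        qed
      qed
    qed
    also have "\<dots> = (SUP n. \<integral>\<^sup>+ t. ennreal (W n t) \<partial>\<theta>)"
    proof (rule nn_integral_monotone_convergence_SUP_AE)
      show "AE t in \<theta>. ennreal (W n t) \<le> ennreal (W (Suc n) t)" for n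
        using all by eventually_elim (auto intro!: ennreal_leI score_mono)
      show "(\<lambda>t. ennreal (W n t)) \<in> borel_measurable \<theta>" for n using int(2)[of n] by measurable
    qed
    finally show ?thesis .
  qed
  have incV: "incseq (\<lambda>n. \<integral>\<^sup>+ t. ennreal (V n t) \<partial>L)"
  proof (rule incseq_SucI, rule nn_integral_mono_AE)
    fix n show "AE t in L. ennreal (V n t) \<le> ennreal (V (Suc n) t)"
      using V_score[of n] V_score[of "Suc n"] by eventually_elim (auto intro!: ennreal_leI score_mono)
  qed
  have incW: "incseq (\<lambda>n. \<integral>\<^sup>+ t. ennreal (W n t) \<partial>\<theta>)"
  proof (rule incseq_SucI, rule nn_integral_mono_AE)
    fix n show "AE t in \<theta>. ennreal (W n t) \<le> ennreal (W (Suc n) t)"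
      using W_score[of n] W_score[of "Suc n"] by eventually_elim (auto intro!: ennreal_leI score_mono)
  qed
  show ?thesis
    unfolding V_lim W_lim ennreal_SUP_add[OF incV incW, symmetric]
    by (rule SUP_least) (rule finite_gain)
qed

lemma path_rate_eq_integrals:
  "path_rate J h T x =
    ereal_integral L (\<lambda>t. conjugate J h (xdot t)) + ereal_integral \<theta> (\<lambda>t. recession J h (g t))"
proof -
  let ?S = "(\<integral>\<^sup>+ t. conj_density t \<partial>L) + (\<integral>\<^sup>+ t. support_density t \<partial>\<theta>)"
  have neg: "e2ennreal (- conjugate J h y) = 0" "e2ennreal (- support y) = 0" for y
    using conjugate_nonneg[of y] support_nonneg[of y] by (simp_all add: e2ennreal_neg)
  have eq: "ereal_integral L (\<lambda>t. conjugate J h (xdot t)) + ereal_integral \<theta> (\<lambda>t. recession J h (g t)) =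
      enn2ereal ?S"
    by (simp add: ereal_integral_def recession_eq_support neg conj_density_def support_density_def
        plus_ennreal.rep_eq zero_ennreal.rep_eq)
  have "path_rate J h T x \<le> enn2ereal ?S"
  proof (cases "?S = top")
    case True
    show ?thesis unfolding True by (simp add: enn2ereal_top)
  next
    case False
    then have fin: "(\<integral>\<^sup>+ t. conj_density t \<partial>L) < \<infinity>" "(\<integral>\<^sup>+ t. support_density t \<partial>\<theta>) < \<infinity>"
      by (auto simp: less_top[symmetric])
    show ?thesis
      unfolding path_rate_eq[OF T]
    proof (rule SUP_least, clarify)
      fix v a assume "strategy_value J k T x a v"
      then have "e2ennreal (ereal v) \<le> ?S" using strategy_le_integrals[OF fin] by simp
      then have "enn2ereal (e2ennreal (ereal v)) \<le> enn2ereal ?S" by (simp only: less_eq_ennreal.rep_eq)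
      moreover have "ereal v \<le> enn2ereal (e2ennreal (ereal v))" by (simp add: ennreal.rep_eq)
      ultimately show "ereal v \<le> enn2ereal ?S" by (rule order_trans[rotated])
    qed
  qed
  moreover have "enn2ereal ?S \<le> path_rate J h T x"
  proof -
    have "enn2ereal ?S \<le> enn2ereal (e2ennreal (path_rate J h T x))"
      using integrals_le_path_rate by (simp only: less_eq_ennreal.rep_eq)
    then show ?thesis by (simp add: enn2ereal_e2ennreal path_rate_nonneg[OF T])
  qed
  ultimately show ?thesis unfolding eq by (rule antisym)
qed

end

section \<open>The rate function of the model\<close>

theorem theorem4p6:
  fixes S :: "'w measure" and P :: "real \<times> real \<Rightarrow> 'w measure" and X V :: "real \<Rightarrow> 'w \<Rightarrow> real"
    and \<phi> \<psi> :: "real \<Rightarrow> complex \<Rightarrow> complex \<Rightarrow> complex" and C :: characteristics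
    and v0 :: real and I J :: "real set" and w :: "real \<Rightarrow> real" and h :: "real \<Rightarrow> ereal"
    and T :: real and x :: "real \<Rightarrow> real"
  defines "J \<equiv> exponent_domain C I w" and "h \<equiv> exponent C I w"
  assumes "standing_assumptions S P X V \<phi> \<psi> C v0 I w"
    and "0 < T"
    and "(\<exists>u1 u2. u1 \<le> u2 \<and> J = {u1..u2} \<and> w u1 = w u2) \<or>
         (\<forall>u. other_equilibrium (R_real C u) (w u) = \<infinity>)"
    and "x 0 = 0"
  shows "(\<not> has_bounded_variation T x \<longrightarrow> path_rate J h T x = \<infinity>) \<and>
    (has_bounded_variation T x \<longrightarrow>
      (\<forall>dx xdot \<nu> \<theta> g.
         path_measure T x dx \<and> lebesgue_decomposition T dx xdot \<nu> \<and>
         finite_measure \<theta> \<and> sets \<theta> = sets (lebesgue_upto T) \<and>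
         abs_continuous_wrt \<theta> \<nu> \<and> is_density \<theta> \<nu> g \<longrightarrow>
         path_rate J h T x =
           ereal_integral (lebesgue_upto T) (\<lambda>t. conjugate J h (xdot t)) +
           ereal_integral \<theta> (\<lambda>t. recession J h (g t))))"
proof -
  interpret standing_assumptions S P X V \<phi> \<psi> C v0 I w by (rule assms(3))
  define k where "k = (\<lambda>u. real_of_ereal (h u))"
  obtain c where c: "\<And>u. u \<in> J \<Longrightarrow> - c \<le> k u"
    unfolding J_def k_def h_def by (rule exponent_lower) blast
  obtain q where q: "q < 0" "exponent C I w q < \<infinity>" using finite_left by blast
  then have qJ: "q \<in> J" unfolding J_def by (auto simp: exponent_def split: if_splits)
  interpret cost_function J h k c
  proof
    show "h u = ereal (k u)" if "u \<in> J" for u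
      using exponent_real that unfolding J_def h_def k_def by blast
    show "0 \<in> J" unfolding J_def by (rule ends_in_domain) simp
    show "k 0 = 0"
      using ends_in_domain[of 0] w_ends(2)[of 0] F_zero_ends[of 0] by (simp add: k_def h_def exponent_def)
    show "- c \<le> k u" if "u \<in> J" for u by (rule c[OF that])
    show "\<exists>p\<in>J. 0 < p" unfolding J_def using ends_in_domain[of 1] by (intro bexI[of _ 1]) auto
    show "\<exists>q\<in>J. q < 0" using q(1) by (intro bexI[OF _ qJ])
  qed
  show ?thesis
  proof (intro conjI impI allI)
    assume "\<not> has_bounded_variation T x"
    then show "path_rate J h T x = \<infinity>" by (rule path_rate_unbounded_variation[OF \<open>0 < T\<close>])
  next
    fix dx xdot \<nu> \<theta> g
    assume *: "path_measure T x dx \<and> lebesgue_decomposition T dx xdot \<nu> \<and>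
      finite_measure \<theta> \<and> sets \<theta> = sets (lebesgue_upto T) \<and> abs_continuous_wrt \<theta> \<nu> \<and> is_density \<theta> \<nu> g"
    have "decomposed_path J h k c T x dx xdot \<nu> \<theta> g"
    proof (intro decomposed_path.intro decomposed_path_axioms.intro)
      show "cost_function J h k c" by (rule cost_function_axioms)
    qed (use * \<open>0 < T\<close> in blast)+
    then show "path_rate J h T x =
        ereal_integral (lebesgue_upto T) (\<lambda>t. conjugate J h (xdot t)) +
        ereal_integral \<theta> (\<lambda>t. recession J h (g t))"
      by (rule decomposed_path.path_rate_eq_integrals)
  qed
qed

end
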